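(* Let $n=2$ or $n=3$, $m=n-1$, $\gamma>1$, and let $(R(x),V(x),C(x))$ be a similarity shock solution (as defined in the context) with similarity exponent $\lambda$. Assume that: (P1) the function $1+V(x)$ is uniformly bounded below away from zero, and uniformly bounded from above, as $x$ varies over all of $\mathbb{R}$; (P2) the limits $\ell=\lim_{x\to 0}V(x)/x$ and $L=\lim_{x\to 0}C(x)/x$ satisfy $-\infty<L<0<\ell<\infty$; (P3) $(V(x),C(x))\to(V_0,-\infty)$ as $x\uparrow\infty$, where $V_0=-\frac{2(\lambda-1)}{n\gamma}$. For $t\in\mathbb{R}$, $r>0$ and $x=t/r^\lambda$ define $$\rho(t,r)=R(x),\qquad u(t,r)=-\frac{r^{1-\lambda}}{\lambda}\frac{V(x)}{x},\qquad c(t,r)=-\frac{r^{1-\lambda}}{\lambda}\frac{C(x)}{x},\qquad e(t,r)=\frac{c(t,r)^2}{\gamma(\gamma-1)},$$ where $V(x)/x$ and $C(x)/x$ are given the values $\ell$ and $L$ at $x=0$. If $$1<\lambda<1+\tfrac{n}{2},$$ then the triple $(\rho,u,e)$ is a radial weak solution (as defined in the context) of the radial compressible Euler system $$(r^m\rho)_t+(r^m\rho u)_r=0,$$ $$(r^m\rho u)_t+(r^m(\rho u^2+p))_r=mr^{m-1}p,$$ $$\Big(r^m\rho\big[e+\tfrac{u^2}{2}\big]\Big)_t+\Big(r^m\rho u\big[e+\tfrac{u^2}{2}+\tfrac{p}{\rho}\big]\Big)_r=0,$$ with the ideal pressure law $p=(\gamma-1)\rho e$.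
   Context: **Similarity shock solution.** Fix $n\in\{2,3\}$, $\gamma>1$, $\lambda>1$. A similarity shock solution consists of a constant $B>0$ and functions $R,V,C$ of $x\in\mathbb{R}$ with the following properties. (The curve $x=-1$, $t<0$, is an incoming shock converging to the origin, and $x=B$, $t>0$, is a reflected outgoing shock.) 1. (Quiescent region) For $x<-1$: $V(x)=C(x)=0$ and $R(x)=1$. 2. (State behind the incoming shock) As $x\downarrow -1$, $(V,C,R)$ tends to its value at $x=-1$: $$V(-1)=-\frac{2}{\gamma+1},\quad C(-1)=\frac{\sqrt{2\gamma(\gamma-1)}}{\gamma+1},\quad R(-1)=\frac{\gamma+1}{\gamma-1}.$$ 3. (Similarity ODEs) On $(-1,B)$ and on $(B,\infty)$ the functions $V,C$ solve $$V'(x)=-\frac{1}{\lambda x}\frac{G(V,C)}{D(V,C)},\qquad C'(x)=-\frac{1}{\lambda x}\frac{F(V,C)}{D(V,C)},$$ at all points other than $x=0$ and one point $x_c\in(-1,0)$ at which $1+V=C$, where $$D=(1+V)^2-C^2,\qquad G=C^2\Big[nV+\tfrac{2(\lambda-1)}{\gamma}\Big]-V(1+V)(\lambda+V),$$ $$F=C\Big\{C^2\Big[1+\tfrac{\lambda-1}{\gamma(1+V)}\Big]-\Big[1+\tfrac{(n-1)(\gamma-1)}{2}\Big](1+V)^2+\Big[\tfrac{(n-1)(\gamma-1)+(\gamma-3)(\lambda-1)}{2}\Big](1+V)-\tfrac{(\gamma-1)(\lambda-1)}{2}\Big\},$$ and $D\neq 0$ at all points of $(-1,B)\cup(B,\infty)$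 other than $x_c$. Moreover $V$ and $C$ are real analytic on $(-1,B)$; in particular they pass analytically through $x=x_c$ (where $F=G=D=0$; this is the requirement that $\lambda$ is the "standard" value $\lambda_{std}$) and through $x=0$, where $V(0)=C(0)=0$. The limits $\ell=\lim_{x\to0}V(x)/x$ and $L=\lim_{x\to0}C(x)/x$ are finite. 4. (Reflected shock) At $x=B$ the one-sided limits satisfy $C(B^\pm)<0$, $C(B^-)^2<(1+V(B^-))^2$, and $$1+V(B^+)=\tfrac{\gamma-1}{\gamma+1}(1+V(B^-))+\tfrac{2C(B^-)^2}{(\gamma+1)(1+V(B^-))},$$ $$C(B^+)^2=C(B^-)^2+\tfrac{\gamma-1}{2}\big[(1+V(B^-))^2-(1+V(B^+))^2\big],$$ $$R(B^+)(1+V(B^+))=R(B^-)(1+V(B^-)).$$ 5. (Density) On each of $(-1,B)$ and $(B,\infty)$, $R$ is $C^1$ and satisfies the similarity ODE for mass conservation, $(R(1+V))'=\frac{nRV}{\lambda x}$, and the exact integral $$R(x)^{q+1-\gamma}\Big(\frac{C(x)}{x}\Big)^2|1+V(x)|^q\equiv\text{constant},\qquad q=\frac{2(\lambda-1)}{n},$$ (with a constant that may differ between the two intervals), where $V/x$, $C/x$ take the values $\ell$, $L$ at $x=0$. The corresponding $(\rho,u,c)$ is a classical solution of the radial Euler system in each of the regions $\{x<-1\}$, $\{-1<x<B\}$, $\{x>B\}$ of $\{(t,r): r>0\}$, and the Rankine–Hugoniot conditions hold across $x=-1$ and $x=B$. At $x=B$ the functions are assigned either one-sided limit. **Notation.**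 $\mathbb{R}^+=(0,\infty)$, $\mathbb{R}^+_0=[0,\infty)$. $L^1_{loc}(r^mdr)$ and $L^1_{loc}(dt\times r^mdr)$ denote local integrability on $\mathbb{R}^+_0$ and $\mathbb{R}\times\mathbb{R}^+_0$ (so up to and including $r=0$) with respect to the indicated measures. $C^1_c(\mathbb{R}\times\mathbb{R}^+_0)$ is the set of real-valued functions $\psi(t,r)$ that are $C^1$ on $\mathbb{R}\times\mathbb{R}^+_0$ (up to $r=0$) and vanish outside $[-\bar t,\bar t]\times[0,\bar r]$ for some $\bar t,\bar r>0$. $C^1_0(\mathbb{R}\times\mathbb{R}^+_0)$ is the set of $\psi\in C^1_c(\mathbb{R}\times\mathbb{R}^+_0)$ with $\psi(t,0)\equiv0$. **Radial weak solution.** Given a pressure function $p=p(\rho,e)\ge0$, measurable functions $\rho,u,e:\mathbb{R}_t\times\mathbb{R}^+_r\to\mathbb{R}$ form a (non-vacuum) radial weak solution of the radial Euler system if: (i) $\rho(t,r)>0$ and $e(t,r)\ge0$ for a.a. $(t,r)\in\mathbb{R}\times\mathbb{R}^+$; (ii) the maps $t\mapsto\rho(t,\cdot)$, $t\mapsto\rho(t,\cdot)u(t,\cdot)$, $t\mapsto\rho(t,\cdot)\big(e(t,\cdot)+\frac{u(t,\cdot)^2}{2}\big)$ belong to $C(\mathbb{R}_t;L^1_{loc}(r^mdr))$; (iii) $\rho u^2$, $p$, and $\big[\rho(e+\frac{u^2}{2})+p\big]u$ belong to $L^1_{loc}(dt\times r^mdr)$; (iv) the following hold: $$\int_{\mathbb{R}}\int_{\mathbb{R}^+}(\rho\psi_t+\rho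 u\psi_r)\,r^mdrdt=0\quad\forall\psi\in C^1_c(\mathbb{R}\times\mathbb{R}^+_0),$$ $$\int_{\mathbb{R}}\int_{\mathbb{R}^+}\Big(\rho u\psi_t+\rho u^2\psi_r+p\big(\psi_r+\tfrac{m\psi}{r}\big)\Big)r^mdrdt=0\quad\forall\psi\in C^1_0(\mathbb{R}\times\mathbb{R}^+_0),$$ $$\int_{\mathbb{R}}\int_{\mathbb{R}^+}\Big(\rho\big(e+\tfrac{u^2}{2}\big)\psi_t+\big[\rho\big(e+\tfrac{u^2}{2}\big)+p\big]u\psi_r\Big)r^mdrdt=0\quad\forall\psi\in C^1_c(\mathbb{R}\times\mathbb{R}^+_0).$$ *)

theory Defs
  imports "HOL-Analysis.Analysis"
begin

text \<open>Functions of time and radius are functions of the pair (t, r); only r > 0 (or r \<ge> 0 for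
  test functions) is ever relevant.\<close>

definition real_analytic_on :: "(real \<Rightarrow> real) \<Rightarrow> real set \<Rightarrow> bool" where
  "real_analytic_on f S \<longleftrightarrow> (\<forall>x\<in>S. \<exists>A. (\<lambda>h. f (x + h)) has_fps_expansion A)"

text \<open>Differentiability is taken within \<open>S\<close>: for open \<open>S\<close> this is the usual notion,
  and for the closed half-plane it is differentiability up to the boundary.\<close>

definition has_C1_partials_on ::
  "(real \<times> real \<Rightarrow> real) \<Rightarrow> (real \<times> real \<Rightarrow> real) \<Rightarrow> (real \<times> real \<Rightarrow> real) \<Rightarrow> (real \<times> real) set \<Rightarrow> bool" where
  "has_C1_partials_on f ft fr S \<longleftrightarrow>
     (\<forall>z\<in>S. (f has_derivative (\<lambda>(a, b). ft z * a + fr z * b)) (at z within S)) \<and>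
     continuous_on S ft \<and> continuous_on S fr"

definition C1_on :: "(real \<times> real \<Rightarrow> real) \<Rightarrow> (real \<times> real) set \<Rightarrow> bool" where
  "C1_on f S \<longleftrightarrow> (\<exists>ft fr. has_C1_partials_on f ft fr S)"

abbreviation half_plane :: "(real \<times> real) set" where
  "half_plane \<equiv> UNIV \<times> {0<..}"

abbreviation closed_half_plane :: "(real \<times> real) set" where
  "closed_half_plane \<equiv> UNIV \<times> {0..}"

text \<open>Integrability over the intervals reaching down to r = 0, not just over compact subsets of r > 0.\<close>

definition L1_loc_r :: "nat \<Rightarrow> (real \<Rightarrow> real) \<Rightarrow> bool" where
  "L1_loc_r m f \<longleftrightarrow> (\<forall>b>0. set_integrable lebesgue {0<..b} (\<lambda>r. f r * r ^ m))"

definition L1_loc_tr :: "nat \<Rightarrow> (real \<times> real \<Rightarrow> real) \<Rightarrow> bool" where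
  "L1_loc_tr m f \<longleftrightarrow>
     (\<forall>T>0. \<forall>b>0. set_integrable lebesgue ({-T..T} \<times> {0<..b}) (\<lambda>(t, r). f (t, r) * r ^ m))"

text \<open>Continuity in time with values in \<open>L1_loc_r m\<close>, whose topology is given by the
  weighted \<open>L\<^sup>1\<close> seminorms over the intervals from 0 to b.\<close>

definition continuous_L1_loc :: "nat \<Rightarrow> (real \<times> real \<Rightarrow> real) \<Rightarrow> bool" where
  "continuous_L1_loc m f \<longleftrightarrow>
     (\<forall>t. L1_loc_r m (\<lambda>r. f (t, r))) \<and>
     (\<forall>t0. \<forall>b>0. ((\<lambda>t. set_lebesgue_integral lebesgue {0<..b} (\<lambda>r. \<bar>f (t, r) - f (t0, r)\<bar> * r ^ m))
        \<longlongrightarrow> 0) (at t0))"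

definition test_C1c ::
  "(real \<times> real \<Rightarrow> real) \<Rightarrow> (real \<times> real \<Rightarrow> real) \<Rightarrow> (real \<times> real \<Rightarrow> real) \<Rightarrow> bool" where
  "test_C1c \<psi> \<psi>t \<psi>r \<longleftrightarrow>
     has_C1_partials_on \<psi> \<psi>t \<psi>r closed_half_plane \<and>
     (\<exists>T>0. \<exists>b>0. \<forall>z \<in> closed_half_plane - {-T..T} \<times> {0..b}. \<psi> z = 0)"

definition test_C10 ::
  "(real \<times> real \<Rightarrow> real) \<Rightarrow> (real \<times> real \<Rightarrow> real) \<Rightarrow> (real \<times> real \<Rightarrow> real) \<Rightarrow> bool" where
  "test_C10 \<psi> \<psi>t \<psi>r \<longleftrightarrow> test_C1c \<psi> \<psi>t \<psi>r \<and> (\<forall>t. \<psi> (t, 0) = 0)"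

text \<open>\<open>P\<close> is the pressure law p = P \<open>\<rho>\<close> e. The relation \<open>has_bochner_integral\<close> is used
  for the weak equations so that a non-integrable integrand (whose integral would be 0 by
  convention) does not satisfy them.\<close>

definition radial_weak_solution ::
  "nat \<Rightarrow> (real \<Rightarrow> real \<Rightarrow> real) \<Rightarrow>
   (real \<times> real \<Rightarrow> real) \<Rightarrow> (real \<times> real \<Rightarrow> real) \<Rightarrow> (real \<times> real \<Rightarrow> real) \<Rightarrow> bool" where
  "radial_weak_solution m P \<rho> u e \<longleftrightarrow>
    (let p = (\<lambda>z. P (\<rho> z) (e z));
         E = (\<lambda>z. \<rho> z * (e z + (u z)\<^sup>2 / 2));
         M = lebesgue_on half_plane
     in
      (\<forall>a>0. \<forall>b\<ge>0. P a b \<ge> 0) \<and>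
      \<rho> \<in> borel_measurable M \<and> u \<in> borel_measurable M \<and> e \<in> borel_measurable M \<and>
      (AE z in M. \<rho> z > 0 \<and> e z \<ge> 0) \<and>
      continuous_L1_loc m \<rho> \<and>
      continuous_L1_loc m (\<lambda>z. \<rho> z * u z) \<and>
      continuous_L1_loc m E \<and>
      L1_loc_tr m (\<lambda>z. \<rho> z * (u z)\<^sup>2) \<and>
      L1_loc_tr m p \<and>
      L1_loc_tr m (\<lambda>z. (E z + p z) * u z) \<and>
      (\<forall>\<psi> \<psi>t \<psi>r. test_C1c \<psi> \<psi>t \<psi>r \<longrightarrow>
         has_bochner_integral M
           (\<lambda>(t, r). (\<rho> (t, r) * \<psi>t (t, r) + \<rho> (t, r) * u (t, r) * \<psi>r (t, r)) * r ^ m) 0) \<and>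
      (\<forall>\<psi> \<psi>t \<psi>r. test_C10 \<psi> \<psi>t \<psi>r \<longrightarrow>
         has_bochner_integral M
           (\<lambda>(t, r). (\<rho> (t, r) * u (t, r) * \<psi>t (t, r) + \<rho> (t, r) * (u (t, r))\<^sup>2 * \<psi>r (t, r)
              + p (t, r) * (\<psi>r (t, r) + real m * \<psi> (t, r) / r)) * r ^ m) 0) \<and>
      (\<forall>\<psi> \<psi>t \<psi>r. test_C1c \<psi> \<psi>t \<psi>r \<longrightarrow>
         has_bochner_integral M
           (\<lambda>(t, r). (E (t, r) * \<psi>t (t, r) + (E (t, r) + p (t, r)) * u (t, r) * \<psi>r (t, r)) * r ^ m) 0))"

definition ideal_pressure :: "real \<Rightarrow> real \<Rightarrow> real \<Rightarrow> real" where
  "ideal_pressure \<gamma> \<rho> e = (\<gamma> - 1) * \<rho> * e"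

definition energy_of_sound_speed :: "real \<Rightarrow> real \<Rightarrow> real" where
  "energy_of_sound_speed \<gamma> c = c\<^sup>2 / (\<gamma> * (\<gamma> - 1))"

definition classical_radial_Euler ::
  "nat \<Rightarrow> real \<Rightarrow> (real \<times> real \<Rightarrow> real) \<Rightarrow> (real \<times> real \<Rightarrow> real) \<Rightarrow> (real \<times> real \<Rightarrow> real) \<Rightarrow>
   (real \<times> real) set \<Rightarrow> bool" where
  "classical_radial_Euler m \<gamma> \<rho> u c S \<longleftrightarrow>
    (let e = (\<lambda>z. energy_of_sound_speed \<gamma> (c z));
         p = (\<lambda>z. ideal_pressure \<gamma> (\<rho> z) (e z));
         E = (\<lambda>z. \<rho> z * (e z + (u z)\<^sup>2 / 2))
     in
      C1_on \<rho> S \<and> C1_on u S \<and> C1_on c S \<and>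
      (\<forall>(t, r)\<in>S.
         deriv (\<lambda>s. r ^ m * \<rho> (s, r)) t
           + deriv (\<lambda>y. y ^ m * \<rho> (t, y) * u (t, y)) r = 0 \<and>
         deriv (\<lambda>s. r ^ m * \<rho> (s, r) * u (s, r)) t
           + deriv (\<lambda>y. y ^ m * (\<rho> (t, y) * (u (t, y))\<^sup>2 + p (t, y))) r
           = real m * r ^ (m - 1) * p (t, r) \<and>
         deriv (\<lambda>s. r ^ m * E (s, r)) t
           + deriv (\<lambda>y. y ^ m * \<rho> (t, y) * u (t, y) *
               (e (t, y) + (u (t, y))\<^sup>2 / 2 + p (t, y) / \<rho> (t, y))) r = 0))"

text \<open>The curve x = k, where \<open>x = t / r\<^sup>\<lambda>\<close>, moves with speed \<open>dr/dt = r / (\<lambda> t)\<close>.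
  The two states at a point of the curve are the limits from the regions x < k and x > k.\<close>

definition Rankine_Hugoniot_across ::
  "real \<Rightarrow> real \<Rightarrow> real \<Rightarrow> (real \<times> real \<Rightarrow> real) \<Rightarrow> (real \<times> real \<Rightarrow> real) \<Rightarrow> (real \<times> real \<Rightarrow> real) \<Rightarrow> bool" where
  "Rankine_Hugoniot_across \<gamma> lam k \<rho> u c \<longleftrightarrow>
    (\<forall>t r. r > 0 \<and> t / r powr lam = k \<longrightarrow>
      (\<exists>\<rho>1 u1 c1 \<rho>2 u2 c2.
        (let F1 = at (t, r) within {(t', r'). r' > 0 \<and> t' / r' powr lam < k};
             F2 = at (t, r) within {(t', r'). r' > 0 \<and> t' / r' powr lam > k};
             s = r / (lam * t);
             e1 = energy_of_sound_speed \<gamma> c1; e2 = energy_of_sound_speed \<gamma> c2;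
             p1 = ideal_pressure \<gamma> \<rho>1 e1; p2 = ideal_pressure \<gamma> \<rho>2 e2;
             E1 = \<rho>1 * (e1 + u1\<^sup>2 / 2); E2 = \<rho>2 * (e2 + u2\<^sup>2 / 2)
         in
          (\<rho> \<longlongrightarrow> \<rho>1) F1 \<and> (u \<longlongrightarrow> u1) F1 \<and> (c \<longlongrightarrow> c1) F1 \<and>
          (\<rho> \<longlongrightarrow> \<rho>2) F2 \<and> (u \<longlongrightarrow> u2) F2 \<and> (c \<longlongrightarrow> c2) F2 \<and>
          s * (\<rho>2 - \<rho>1) = \<rho>2 * u2 - \<rho>1 * u1 \<and>
          s * (\<rho>2 * u2 - \<rho>1 * u1) = (\<rho>2 * u2\<^sup>2 + p2) - (\<rho>1 * u1\<^sup>2 + p1) \<and>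
          s * (E2 - E1) = (E2 + p2) * u2 - (E1 + p1) * u1)))"

definition quot_at0 :: "(real \<Rightarrow> real) \<Rightarrow> real \<Rightarrow> real \<Rightarrow> real" where
  "quot_at0 f a x = (if x = 0 then a else f x / x)"

definition sim_rho :: "real \<Rightarrow> (real \<Rightarrow> real) \<Rightarrow> real \<times> real \<Rightarrow> real" where
  "sim_rho lam R = (\<lambda>(t, r). R (t / r powr lam))"

text \<open>The velocity for \<open>f = V\<close>, \<open>a = \<ell>\<close>, and the sound speed for \<open>f = C\<close>, \<open>a = L\<close>.\<close>

definition sim_speed :: "real \<Rightarrow> (real \<Rightarrow> real) \<Rightarrow> real \<Rightarrow> real \<times> real \<Rightarrow> real" where
  "sim_speed lam f a = (\<lambda>(t, r). - (r powr (1 - lam) / lam) * quot_at0 f a (t / r powr lam))"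

definition sim_D :: "real \<Rightarrow> real \<Rightarrow> real" where
  "sim_D V C = (1 + V)\<^sup>2 - C\<^sup>2"

definition sim_G :: "nat \<Rightarrow> real \<Rightarrow> real \<Rightarrow> real \<Rightarrow> real \<Rightarrow> real" where
  "sim_G n \<gamma> lam V C =
     C\<^sup>2 * (real n * V + 2 * (lam - 1) / \<gamma>) - V * (1 + V) * (lam + V)"

definition sim_F :: "nat \<Rightarrow> real \<Rightarrow> real \<Rightarrow> real \<Rightarrow> real \<Rightarrow> real" where
  "sim_F n \<gamma> lam V C =
     C * (C\<^sup>2 * (1 + (lam - 1) / (\<gamma> * (1 + V)))
          - (1 + (real n - 1) * (\<gamma> - 1) / 2) * (1 + V)\<^sup>2
          + (((real n - 1) * (\<gamma> - 1) + (\<gamma> - 3) * (lam - 1)) / 2) * (1 + V)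
          - (\<gamma> - 1) * (lam - 1) / 2)"

locale similarity_shock_solution =
  fixes n :: nat and \<gamma> lam B :: real and R V C :: "real \<Rightarrow> real" and l L :: real
  assumes n_cases: "n = 2 \<or> n = 3" and gamma_gt_1: "\<gamma> > 1" and lam_gt_1: "lam > 1"
    and B_pos: "B > 0"
    and quiescent: "\<And>x. x < -1 \<Longrightarrow> V x = 0 \<and> C x = 0 \<and> R x = 1"
    and incoming_state:
      "V (-1) = - 2 / (\<gamma> + 1)"
      "C (-1) = sqrt (2 * \<gamma> * (\<gamma> - 1)) / (\<gamma> + 1)"
      "R (-1) = (\<gamma> + 1) / (\<gamma> - 1)"
    and incoming_limits:
      "(V \<longlongrightarrow> V (-1)) (at_right (-1))"
      "(C \<longlongrightarrow> C (-1)) (at_right (-1))"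
      "(R \<longlongrightarrow> R (-1)) (at_right (-1))"
    and similarity_ODEs:
      "\<exists>xc. -1 < xc \<and> xc < 0 \<and> 1 + V xc = C xc \<and>
         sim_F n \<gamma> lam (V xc) (C xc) = 0 \<and> sim_G n \<gamma> lam (V xc) (C xc) = 0 \<and>
         sim_D (V xc) (C xc) = 0 \<and>
         (\<forall>x \<in> ({-1<..<B} \<union> {B<..}) - {xc}. sim_D (V x) (C x) \<noteq> 0) \<and>
         (\<forall>x \<in> ({-1<..<B} \<union> {B<..}) - {0, xc}.
            (V has_real_derivative
               - (1 / (lam * x)) * (sim_G n \<gamma> lam (V x) (C x) / sim_D (V x) (C x))) (at x) \<and>
            (C has_real_derivative
               - (1 / (lam * x)) * (sim_F n \<gamma> lam (V x) (C x) / sim_D (V x) (C x))) (at x))"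
    and analytic:
      "real_analytic_on V {-1<..<B}" "real_analytic_on C {-1<..<B}"
    and at_zero:
      "V 0 = 0" "C 0 = 0"
      "((\<lambda>x. V x / x) \<longlongrightarrow> l) (at 0)"
      "((\<lambda>x. C x / x) \<longlongrightarrow> L) (at 0)"
    and reflected_shock:
      "\<exists>V1 C1 R1 V2 C2 R2.
         (V \<longlongrightarrow> V1) (at_left B) \<and> (C \<longlongrightarrow> C1) (at_left B) \<and> (R \<longlongrightarrow> R1) (at_left B) \<and>
         (V \<longlongrightarrow> V2) (at_right B) \<and> (C \<longlongrightarrow> C2) (at_right B) \<and> (R \<longlongrightarrow> R2) (at_right B) \<and>
         C1 < 0 \<and> C2 < 0 \<and> C1\<^sup>2 < (1 + V1)\<^sup>2 \<and>
         1 + V2 = (\<gamma> - 1) / (\<gamma> + 1) * (1 + V1) + 2 * C1\<^sup>2 / ((\<gamma> + 1) * (1 + V1)) \<and>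
         C2\<^sup>2 = C1\<^sup>2 + (\<gamma> - 1) / 2 * ((1 + V1)\<^sup>2 - (1 + V2)\<^sup>2) \<and>
         R2 * (1 + V2) = R1 * (1 + V1) \<and>
         V B \<in> {V1, V2} \<and> C B \<in> {C1, C2} \<and> R B \<in> {R1, R2}"
    and density_C1:
      "R C1_differentiable_on {-1<..<B}" "R C1_differentiable_on {B<..}"
    and density_ODE:
      "\<And>x. x \<in> {-1<..<B} \<union> {B<..} \<Longrightarrow>
         ((\<lambda>y. R y * (1 + V y)) has_real_derivative (real n * R x / lam * quot_at0 V l x)) (at x)"
    and exact_integral:
      "\<And>S. S \<in> {{-1<..<B}, {B<..}} \<Longrightarrow>
         \<exists>k. \<forall>x\<in>S. (let q = 2 * (lam - 1) / real n in
           R x powr (q + 1 - \<gamma>) * (quot_at0 C L x)\<^sup>2 * \<bar>1 + V x\<bar> powr q = k)"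
    and classical:
      "\<And>X. X \<in> {{..<-1}, {-1<..<B}, {B<..}} \<Longrightarrow>
         classical_radial_Euler (n - 1) \<gamma> (sim_rho lam R) (sim_speed lam V l) (sim_speed lam C L)
           {(t, r). r > 0 \<and> t / r powr lam \<in> X}"
    and Rankine_Hugoniot:
      "\<And>k. k \<in> {-1, B} \<Longrightarrow>
         Rankine_Hugoniot_across \<gamma> lam k (sim_rho lam R) (sim_speed lam V l) (sim_speed lam C L)"

end

theory Submission
  imports Defs
begin

text \<open>
Put \<open>x = t / r\<^sup>\<lambda>\<close>. Each of the three conservation laws has the form \<open>q\<^sub>t + f\<^sub>r = s\<close>, where \<open>q\<close>, \<open>f\<close>
and \<open>s\<close> are functions \<open>Q\<close>, \<open>F\<close>, \<open>S\<close> of x times \<open>r\<^bsup>a\<^esup>\<close>, \<open>r\<^bsup>a + 1 - \<lambda>\<^esup>\<close>, \<open>r\<^bsup>a - \<lambda>\<^esup>\<close>. With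
\<open>H = Q - \<lambda> x F\<close> the law reads \<open>H' = S - (a + 1) F\<close> between the shocks, and the Rankine-Hugoniot
condition says that H is continuous across them. For a test function \<open>\<psi>\<close>, written as \<open>\<Psi>(x, r)\<close> in
the coordinates x and r, this turns the integrand of the weak formulation, times the Jacobian
\<open>r\<^sup>\<lambda>\<close>, into
  \<open>r\<^bsup>a\<^esup> \<partial>\<^sub>x(H \<Psi>) + F \<partial>\<^sub>r(r\<^bsup>a + 1\<^esup> \<Psi>)\<close>.
By Fubini's theorem on \<open>r \<ge> \<delta>\<close> the first summand integrates to 0, since H is continuous and \<open>\<Psi>\<close>
has compact support in x, and the second one to minus the flux through \<open>r = \<delta>\<close>
(\<open>integral_truncated\<close>). No integration along the shock curves is needed. The weak equations
therefore hold as soon as the integrands are integrable up to the centre and the flux through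
\<open>r = \<delta>\<close> tends to 0 (\<open>weak_balance_law\<close>).

Both come from uniform bounds on the profiles. The density is positive and bounded, by the linear
equation for \<open>R (1 + V)\<close> and the negative limit of V as x tends to \<open>\<infinity>\<close> (\<open>density_bounds\<close>). The exact
integral then bounds \<open>R (C / x)\<^sup>2\<close> (\<open>sound_speed_bound\<close>), and \<open>V / x\<close> is bounded and decays at least
like \<open>1 / \<bar>x\<bar>\<close>. So mass, momentum and energy densities are at most of order \<open>r\<^bsup>2 - 2 \<lambda>\<^esup>\<close> near the
centre, uniformly in time, which is integrable against \<open>r\<^sup>m\<close> exactly when \<open>\<lambda> < 1 + n / 2\<close>; continuity in
time follows by dominated convergence.

For the energy flux the same estimate gives only \<open>r\<^bsup>3 - 3 \<lambda>\<^esup>\<close>, which may be too singular.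
Here the decay of the velocity helps: \<open>\<bar>V / x\<bar>\<close> is at most a constant times \<open>\<bar>x\<bar>\<^bsup>-\<theta>\<^esup>\<close> for
every \<open>\<theta>\<close> in \<open>[0, 1)\<close>, which gains a factor \<open>r\<^bsup>\<lambda> \<theta>\<^esup>\<close> and costs \<open>\<bar>t\<bar>\<^bsup>-\<theta>\<^esup>\<close>, still integrable
in time. With \<open>\<theta>\<close> close to 1 the flux through a small sphere tends to 0, under the same condition on
\<open>\<lambda>\<close> (\<open>decay_exponent\<close>). In the momentum law the flux contains the pressure, which need not decay in
x, but there the test functions vanish at the centre and contribute a factor r.
\<close>

section \<open>Integrability and continuity of self-similar functions\<close>

lemma integrable_powr_near_0:
  fixes k b :: real
  assumes "k > -1"
  shows "integrable lborel (\<lambda>r. indicator {0<..b} r * r powr k)"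
proof (cases "b \<ge> 0")
  case True
  have "set_integrable lebesgue {0<..b} (\<lambda>r. r powr k)"
    using integrable_on_powr_from_0'[OF assms True]
    by (intro nonnegative_absolutely_integrable_1) auto
  then show ?thesis
    unfolding set_integrable_def by (subst (asm) integrable_completion) auto
qed simp

lemma integrable_abs_powr:
  fixes \<theta> T :: real
  assumes "\<theta> < 1"
  shows "integrable lborel (\<lambda>t. indicator {-T..T} t * \<bar>t\<bar> powr (-\<theta>))"
proof -
  let ?h = "\<lambda>t. indicator {0<..T} t * t powr (-\<theta>) :: real"
  have h: "integrable lborel ?h"
    using assms by (intro integrable_powr_near_0) auto
  have "integrable lborel (\<lambda>t. ?h (0 + (-1) * t))"
    by (rule lborel_integrable_real_affine[OF h]) simp
  from Bochner_Integration.integrable_add[OF h this] show ?thesis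
    by (rule Bochner_Integration.integrable_cong[THEN iffD1, rotated -1])
       (auto simp: indicator_def)
qed

lemma integrable_product_real:
  fixes f g :: "real \<Rightarrow> real"
  assumes f: "integrable lborel f" and g: "integrable lborel g"
  shows "integrable lborel (\<lambda>(x, y). f x * g y)"
proof -
  have "integrable (lborel \<Otimes>\<^sub>M lborel) (\<lambda>(x, y). f x * g y)"
  proof (rule lborel_pair.Fubini_integrable)
    have [measurable]: "f \<in> borel_measurable borel" "g \<in> borel_measurable borel"
      using f g by auto
    show "(\<lambda>(x, y). f x * g y) \<in> borel_measurable (lborel \<Otimes>\<^sub>M lborel)"
      by measurable
    show "integrable lborel (\<lambda>x. \<integral>y. norm (case (x, y) of (x, y) \<Rightarrow> f x * g y) \<partial>lborel)"
      using f g by (auto simp: abs_mult)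
    show "AE x in lborel. integrable lborel (\<lambda>y. case (x, y) of (x, y) \<Rightarrow> f x * g y)"
      using g by auto
  qed
  then show ?thesis by (simp add: lborel_prod)
qed

lemma integrable_power_weight:
  fixes \<theta> k T b :: real
  assumes "\<theta> < 1" "k > -1"
  shows "integrable lborel (\<lambda>(t, r). (indicator {-T..T} t * \<bar>t\<bar> powr (-\<theta>)) * (indicator {0<..b} r * r powr k))"
  using integrable_product_real[OF integrable_abs_powr[OF assms(1), of T] integrable_powr_near_0[OF assms(2), of b]]
  by (simp add: case_prod_unfold)

lemma AE_time_nonzero: "AE z :: real \<times> real in lborel. fst z \<noteq> 0"
proof -
  have "AE z :: real \<times> real in lborel \<Otimes>\<^sub>M lborel. fst z \<noteq> 0"
  proof (rule lborel_pair.AE_pair_measure)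
    show "{z \<in> space (lborel \<Otimes>\<^sub>M lborel). fst (z :: real \<times> real) \<noteq> 0} \<in> sets (lborel \<Otimes>\<^sub>M lborel)"
      by measurable
    show "AE x in lborel. AE y in lborel. fst (x, y :: real) \<noteq> (0 :: real)"
      using AE_lborel_singleton[of "0 :: real"] by auto
  qed
  then show ?thesis unfolding lborel_prod .
qed

text \<open>The factor \<open>\<bar>t\<bar>\<^bsup>-\<theta>\<^esup>\<close> is integrable in time and may buy a better power of r. The energy flux
needs this when \<open>\<lambda>\<close> is large.\<close>

lemma L1_loc_tr_powr_bound:
  fixes f g :: "real \<times> real \<Rightarrow> real" and k \<theta> K :: real
  assumes eq: "\<And>t r. r > 0 \<Longrightarrow> f (t, r) * r ^ m = g (t, r)"
    and [measurable]: "g \<in> borel_measurable borel"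
    and bound: "\<And>t r. r > 0 \<Longrightarrow> t \<noteq> 0 \<Longrightarrow> \<bar>g (t, r)\<bar> \<le> K * (\<bar>t\<bar> powr (-\<theta>) * r powr k)"
    and "\<theta> < 1" "k > -1"
  shows "L1_loc_tr m f"
  unfolding L1_loc_tr_def
proof (intro allI impI)
  fix T b :: real
  assume "T > 0" "b > 0"
  let ?S = "{-T..T} \<times> {0<..b}"
  have [measurable]: "?S \<in> sets borel"
    by (intro borel_Times) auto
  have "integrable lborel (\<lambda>z. indicator ?S z * g z)"
  proof (rule Bochner_Integration.integrable_bound)
    show "integrable lborel (\<lambda>z. K * (case z of (t, r) \<Rightarrow>
      (indicator {-T..T} t * \<bar>t\<bar> powr (-\<theta>)) * (indicator {0<..b} r * r powr k)))"
      using integrable_power_weight[OF assms(4,5), of T b] by simp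
    show "AE z in lborel. norm (indicator ?S z * g z) \<le> norm (K * (case z of (t, r) \<Rightarrow>
      (indicator {-T..T} t * \<bar>t\<bar> powr (-\<theta>)) * (indicator {0<..b} r * r powr k)))"
      using AE_time_nonzero
    proof eventually_elim
      case (elim z)
      show ?case
        using bound[of "snd z" "fst z"] elim
        by (cases z) (auto simp: indicator_def intro: order_trans[OF _ abs_ge_self])
    qed
  qed measurable
  then have "integrable lebesgue (\<lambda>z. indicator ?S z * g z)"
    by (subst integrable_completion) auto
  then show "set_integrable lebesgue ?S (\<lambda>(t, r). f (t, r) * r ^ m)"
    unfolding set_integrable_def
    by (rule Bochner_Integration.integrable_cong[THEN iffD1, rotated -1]) (auto simp: indicator_def eq)
qed

lemma self_similar_measurable [measurable]:
  fixes \<Phi> :: "real \<Rightarrow> real"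
  assumes [measurable]: "\<Phi> \<in> borel_measurable borel"
  shows "(\<lambda>(t, r). r powr \<alpha> * \<Phi> (t / r powr lam)) \<in> borel_measurable (borel :: (real \<times> real) measure)"
  by (simp add: borel_prod[symmetric])

text \<open>Dominated convergence: for a fixed time \<open>t0 \<noteq> 0\<close>, each of the finitely many discontinuities of the
profile is met at a single radius, and for \<open>t0 = 0\<close> the profile is only evaluated at 0, where it is
continuous.\<close>

lemma continuous_L1_loc_self_similar:
  fixes \<Phi> :: "real \<Rightarrow> real" and f :: "real \<times> real \<Rightarrow> real"
  assumes f: "\<And>t r. r > 0 \<Longrightarrow> f (t, r) = r powr \<alpha> * \<Phi> (t / r powr lam)"
    and [measurable]: "\<Phi> \<in> borel_measurable borel"
    and bound: "\<And>x. \<bar>\<Phi> x\<bar> \<le> K"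
    and N: "finite N" "0 \<notin> N" "\<And>x. x \<notin> N \<Longrightarrow> isCont \<Phi> x"
    and "\<alpha> + real m > -1" "lam > 0"
  shows "continuous_L1_loc m f"
proof -
  define g where "g t b r = indicator {0<..b} r * (r powr (\<alpha> + real m) * \<Phi> (t / r powr lam))"
    for t b r :: real
  have [measurable]: "g t b \<in> borel_measurable lborel" for t b
    unfolding g_def by measurable
  have [measurable]: "g t b \<in> borel_measurable lebesgue" for t b
    by (rule measurable_completion) measurable
  have weight: "integrable lebesgue (\<lambda>r. c * (indicator {0<..b} r * r powr (\<alpha> + real m)))" for b c :: real
    using integrable_powr_near_0[OF assms(7), of b] by (subst integrable_completion) auto
  have g_eq: "indicator {0<..b} r * (f (t, r) * r ^ m) = g t b r" for t b r
    using f[of r t] by (auto simp: g_def indicator_def powr_add powr_realpow)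
  have g_bound: "\<bar>g t b r\<bar> \<le> K * (indicator {0<..b} r * r powr (\<alpha> + real m))" for t b r
    using bound[of "t / r powr lam"] mult_left_mono[of "\<bar>\<Phi> (t / r powr lam)\<bar>" K "r powr (\<alpha> + real m)"]
    by (auto simp: g_def indicator_def abs_mult mult.commute)
  have g_int: "integrable lebesgue (g t b)" for t b
    by (rule Bochner_Integration.integrable_bound[OF weight[of K b]])
       (use g_bound in \<open>auto intro!: measurable_completion order_trans[OF _ abs_ge_self]\<close>)
  have lim: "((\<lambda>t. \<integral>r. \<bar>g t b r - g t0 b r\<bar> \<partial>lebesgue) \<longlongrightarrow> 0) (at t0)" for t0 b
    unfolding tendsto_at_iff_sequentially
  proof (intro allI impI)
    fix X :: "nat \<Rightarrow> real"
    assume "X \<longlonglongrightarrow> t0"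
    let ?E = "{r. r > 0 \<and> t0 / r powr lam \<in> N}"
    have "?E \<subseteq> (\<lambda>k. (t0 / k) powr (1 / lam)) ` N"
    proof
      fix r assume "r \<in> ?E"
      then have "r > 0" "t0 / r powr lam \<in> N" by auto
      moreover from this N have "t0 \<noteq> 0" by auto
      ultimately have "r = (t0 / (t0 / r powr lam)) powr (1 / lam)"
        using \<open>lam > 0\<close> by (simp add: powr_powr)
      with \<open>t0 / r powr lam \<in> N\<close> show "r \<in> (\<lambda>k. (t0 / k) powr (1 / lam)) ` N" by blast
    qed
    then have "finite ?E" using N finite_subset by blast
    then have "?E \<in> null_sets lborel" by (rule finite_imp_null_set_lborel)
    then have "AE r in lborel. r \<notin> ?E" by (rule AE_not_in)
    then have AE: "AE r in lebesgue. r \<notin> ?E" by (rule AE_completion)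
    have "(\<lambda>i. \<integral>r. \<bar>g (X i) b r - g t0 b r\<bar> \<partial>lebesgue) \<longlonglongrightarrow> (\<integral>r. 0 \<partial>(lebesgue :: real measure))"
    proof (rule integral_dominated_convergence)
      show "integrable lebesgue (\<lambda>r. (2 * K) * (indicator {0<..b} r * r powr (\<alpha> + real m)))"
        by (rule weight)
      show "AE r in lebesgue. (\<lambda>i. \<bar>g (X i) b r - g t0 b r\<bar>) \<longlonglongrightarrow> 0"
        using AE
      proof eventually_elim
        case (elim r)
        show ?case
        proof (cases "r > 0")
          case True
          with elim have "isCont \<Phi> (t0 / r powr lam)" using N by auto
          then have "(\<lambda>i. \<Phi> (X i / r powr lam)) \<longlonglongrightarrow> \<Phi> (t0 / r powr lam)"
            by (rule isCont_tendsto_compose) (intro tendsto_intros \<open>X \<longlonglongrightarrow> t0\<close>, use True in auto)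
          then have "(\<lambda>i. g (X i) b r) \<longlonglongrightarrow> g t0 b r"
            unfolding g_def by (intro tendsto_intros)
          then show ?thesis
            by (intro tendsto_rabs_zero LIM_zero)
        qed (simp add: g_def)
      qed
      show "AE r in lebesgue. norm \<bar>g (X i) b r - g t0 b r\<bar> \<le> (2 * K) * (indicator {0<..b} r * r powr (\<alpha> + real m))" for i
      proof (intro AE_I2)
        fix r
        have "\<bar>g (X i) b r - g t0 b r\<bar> \<le> \<bar>g (X i) b r\<bar> + \<bar>g t0 b r\<bar>"
          by (rule abs_triangle_ineq4)
        also have "\<dots> \<le> (2 * K) * (indicator {0<..b} r * r powr (\<alpha> + real m))"
          using g_bound[of "X i" b r] g_bound[of t0 b r] by linarith
        finally show "norm \<bar>g (X i) b r - g t0 b r\<bar> \<le> (2 * K) * (indicator {0<..b} r * r powr (\<alpha> + real m))"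
          by simp
      qed
    qed measurable
    then show "((\<lambda>t. \<integral>r. \<bar>g t b r - g t0 b r\<bar> \<partial>lebesgue) \<circ> X) \<longlonglongrightarrow> 0"
      by (simp add: o_def)
  qed
  have "L1_loc_r m (\<lambda>r. f (t, r))" for t
    unfolding L1_loc_r_def set_integrable_def using g_int by (simp add: g_eq)
  moreover have "((\<lambda>t. set_lebesgue_integral lebesgue {0<..b} (\<lambda>r. \<bar>f (t, r) - f (t0, r)\<bar> * r ^ m)) \<longlongrightarrow> 0) (at t0)" for t0 b
  proof -
    have "indicator {0<..b} r *\<^sub>R (\<bar>f (t, r) - f (t0, r)\<bar> * r ^ m) = \<bar>g t b r - g t0 b r\<bar>" for r t
      unfolding g_eq[symmetric] by (auto simp: indicator_def abs_mult simp flip: left_diff_distrib)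
    then show ?thesis
      unfolding set_lebesgue_integral_def using lim[where b = b and ?t0.0 = t0] by simp
  qed
  ultimately show ?thesis unfolding continuous_L1_loc_def by blast
qed

section \<open>Test functions\<close>

text \<open>What the weak formulation uses of a test function, for \<open>r > 0\<close> only. The number j is the order
of vanishing at the centre: 0 in general, 1 if the function is zero on \<open>r = 0\<close>.\<close>

locale radial_test_function =
  fixes \<psi> \<psi>t \<psi>r :: "real \<times> real \<Rightarrow> real" and T b M j :: real
  assumes j_le_1: "j \<le> 1"
    and deriv: "\<And>t r. r > 0 \<Longrightarrow>
      (\<psi> has_derivative (\<lambda>(x, y). \<psi>t (t, r) * x + \<psi>r (t, r) * y)) (at (t, r))"
    and cont_partials: "continuous_on half_plane \<psi>t" "continuous_on half_plane \<psi>r"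
    and support: "\<And>t r. r > 0 \<Longrightarrow> T < \<bar>t\<bar> \<or> b < r \<Longrightarrow>
      \<psi> (t, r) = 0 \<and> \<psi>t (t, r) = 0 \<and> \<psi>r (t, r) = 0"
    and bound: "\<And>t r. r > 0 \<Longrightarrow> \<bar>\<psi> (t, r)\<bar> \<le> M * r powr j"
    and bound_partials: "\<And>t r. r > 0 \<Longrightarrow> \<bar>\<psi>t (t, r)\<bar> \<le> M" "\<And>t r. r > 0 \<Longrightarrow> \<bar>\<psi>r (t, r)\<bar> \<le> M"
begin

lemma M_nonneg: "M \<ge> 0"
  using bound_partials(1)[of 1 0] by (meson abs_ge_zero order_trans zero_less_one)

lemma cont: "continuous_on half_plane \<psi>"
  unfolding continuous_on_eq_continuous_within
proof
  fix z :: "real \<times> real"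
  assume "z \<in> half_plane"
  then show "continuous (at z within half_plane) \<psi>"
    by (cases z) (auto intro!: has_derivative_continuous[OF has_derivative_at_withinI[OF deriv]])
qed

lemma deriv_along:
  assumes "(p has_real_derivative p') (at s)" "(q has_real_derivative q') (at s)" "q s > 0"
  shows "((\<lambda>s. \<psi> (p s, q s)) has_real_derivative \<psi>t (p s, q s) * p' + \<psi>r (p s, q s) * q') (at s)"
proof -
  have "((\<lambda>s. (p s, q s)) has_derivative (\<lambda>h. (p' * h, q' * h))) (at s)"
    using assms(1,2) unfolding has_field_derivative_def by (rule has_derivative_Pair)
  from has_derivative_compose[OF this deriv[OF assms(3)]] show ?thesis
    unfolding has_field_derivative_def by (rule has_derivative_eq_rhs) (auto simp: algebra_simps)
qed

end

text \<open>The partial derivatives are bounded because they are continuous on the compact box that carries the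
support; the linear bound then follows from the mean value theorem in r.\<close>

lemma test_C1c_cases:
  assumes "test_C1c \<psi> \<psi>t \<psi>r"
  obtains T b M where "radial_test_function \<psi> \<psi>t \<psi>r T b M 0"
    "\<And>t. \<psi> (t, 0) = 0 \<Longrightarrow> (\<And>r. r > 0 \<Longrightarrow> \<bar>\<psi> (t, r)\<bar> \<le> M * r)"
proof -
  obtain T b where Tb: "T > 0" "b > 0" and zero: "\<And>z. z \<in> closed_half_plane - {-T..T} \<times> {0..b} \<Longrightarrow> \<psi> z = 0"
    and part: "has_C1_partials_on \<psi> \<psi>t \<psi>r closed_half_plane"
    using assms unfolding test_C1c_def by blast
  have dw: "(\<psi> has_derivative (\<lambda>(x, y). \<psi>t z * x + \<psi>r z * y)) (at z within closed_half_plane)"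
    if "z \<in> closed_half_plane" for z
    using part that unfolding has_C1_partials_on_def by blast
  have c: "continuous_on closed_half_plane \<psi>t" "continuous_on closed_half_plane \<psi>r"
    using part unfolding has_C1_partials_on_def by auto
  have c\<psi>: "continuous_on closed_half_plane \<psi>"
    by (rule has_derivative_continuous_on) (rule dw)
  have hp: "half_plane \<subseteq> closed_half_plane" by auto
  have oh: "open half_plane" by (intro open_Times) auto
  have d: "(\<psi> has_derivative (\<lambda>(x, y). \<psi>t (t, r) * x + \<psi>r (t, r) * y)) (at (t, r))" if "r > 0" for t r
    using has_derivative_subset[OF dw hp, of "(t, r)"] at_within_open[OF _ oh, of "(t, r)"] that by auto
  have supp: "\<psi> (t, r) = 0 \<and> \<psi>t (t, r) = 0 \<and> \<psi>r (t, r) = 0" if "r > 0" "T < \<bar>t\<bar> \<or> b < r" for t r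
  proof -
    let ?O = "half_plane - {-T..T} \<times> {0..b}"
    have "open ?O" by (intro open_Diff oh closed_Times) auto
    moreover have in_O: "(t, r) \<in> ?O" using that by auto
    moreover have "0 = \<psi> z" if "z \<in> ?O" for z using zero[of z] hp that by (cases z) auto
    ultimately have "(\<psi> has_derivative (\<lambda>z. 0)) (at (t, r))"
      by (intro has_derivative_transform_within_open[OF has_derivative_const[of 0]])
    from has_derivative_unique[OF d[OF that(1)] this]
    have "(\<lambda>(x, y). \<psi>t (t, r) * x + \<psi>r (t, r) * y) = (\<lambda>z. 0)" .
    from fun_cong[OF this, of "(1, 0)"] fun_cong[OF this, of "(0, 1)"] zero[of "(t, r)"] in_O hp
    show ?thesis by auto
  qed
  have K: "\<exists>M. \<forall>t r. \<bar>t\<bar> \<le> T \<and> 0 \<le> r \<and> r \<le> b \<longrightarrow> \<bar>f (t, r)\<bar> \<le> M"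
    if "continuous_on closed_half_plane f" for f :: "real \<times> real \<Rightarrow> real"
  proof -
    have "compact (f ` ({-T..T} \<times> {0..b}))"
      by (intro compact_continuous_image continuous_on_subset[OF that] compact_Times) auto
    then have "bounded (f ` ({-T..T} \<times> {0..b}))" by (rule compact_imp_bounded)
    then obtain M where "\<And>y. y \<in> f ` ({-T..T} \<times> {0..b}) \<Longrightarrow> \<bar>y\<bar> \<le> M"
      unfolding bounded_iff real_norm_def by blast
    moreover have "f (t, r) \<in> f ` ({-T..T} \<times> {0..b})" if "\<bar>t\<bar> \<le> T" "0 \<le> r" "r \<le> b" for t r
      using that by (intro imageI) auto
    ultimately have "\<bar>f (t, r)\<bar> \<le> M" if "\<bar>t\<bar> \<le> T" "0 \<le> r" "r \<le> b" for t r
      using that by blast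
    then show ?thesis by blast
  qed
  obtain M1 M2 M3 where M: "\<And>t r. \<bar>t\<bar> \<le> T \<Longrightarrow> 0 \<le> r \<Longrightarrow> r \<le> b \<Longrightarrow> \<bar>\<psi> (t, r)\<bar> \<le> M1"
    "\<And>t r. \<bar>t\<bar> \<le> T \<Longrightarrow> 0 \<le> r \<Longrightarrow> r \<le> b \<Longrightarrow> \<bar>\<psi>t (t, r)\<bar> \<le> M2"
    "\<And>t r. \<bar>t\<bar> \<le> T \<Longrightarrow> 0 \<le> r \<Longrightarrow> r \<le> b \<Longrightarrow> \<bar>\<psi>r (t, r)\<bar> \<le> M3"
    using K[OF c\<psi>] K[OF c(1)] K[OF c(2)] by blast
  define M where "M = \<bar>M1\<bar> + \<bar>M2\<bar> + \<bar>M3\<bar>"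
  have B: "\<bar>\<psi> (t, r)\<bar> \<le> M \<and> \<bar>\<psi>t (t, r)\<bar> \<le> M \<and> \<bar>\<psi>r (t, r)\<bar> \<le> M" if "r > 0" for t r
  proof (cases "\<bar>t\<bar> \<le> T \<and> r \<le> b")
    case True
    with M[of t r] that show ?thesis unfolding M_def by linarith
  next
    case False
    then have "T < \<bar>t\<bar> \<or> b < r" by linarith
    from supp[OF that this] show ?thesis unfolding M_def by simp
  qed
  show thesis
  proof (rule that)
    show "radial_test_function \<psi> \<psi>t \<psi>r T b M 0"
      using Tb d supp B continuous_on_subset[OF c(1) hp] continuous_on_subset[OF c(2) hp]
      by (simp add: radial_test_function_def)
    fix t r :: real
    assume t0: "\<psi> (t, 0) = 0" and r: "r > 0"
    have "continuous_on {0..r} (\<lambda>y. \<psi> (t, y))"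
      by (rule continuous_on_compose2[OF c\<psi>]) (auto intro!: continuous_intros)
    moreover have "((\<lambda>y. \<psi> (t, y)) has_derivative (\<lambda>h. \<psi>r (t, y) * h)) (at y)" if "y > 0" for y
    proof -
      have "((\<lambda>y. (t, y)) has_derivative (\<lambda>h. (0, h))) (at y)"
        by (auto intro!: derivative_eq_intros)
      from has_derivative_compose[OF this d[OF that]] show ?thesis by simp
    qed
    ultimately obtain y where "0 < y" "y < r" "\<psi> (t, r) - \<psi> (t, 0) = \<psi>r (t, y) * (r - 0)"
      by (rule mvt[OF r]) auto
    then show "\<bar>\<psi> (t, r)\<bar> \<le> M * r"
      using B[of y t] t0 r by (auto simp: abs_mult intro!: mult_right_mono)
  qed
qed

lemma radial_test_function_C1c:
  assumes "test_C1c \<psi> \<psi>t \<psi>r"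
  obtains T b M where "radial_test_function \<psi> \<psi>t \<psi>r T b M 0"
  by (rule test_C1c_cases[OF assms]) (rule that)

lemma radial_test_function_C10:
  assumes "test_C10 \<psi> \<psi>t \<psi>r"
  obtains T b M where "radial_test_function \<psi> \<psi>t \<psi>r T b M 1"
proof -
  have C1c: "test_C1c \<psi> \<psi>t \<psi>r" and zero: "\<And>t. \<psi> (t, 0) = 0"
    using assms unfolding test_C10_def by auto
  obtain T b M where "radial_test_function \<psi> \<psi>t \<psi>r T b M 0"
    and linear: "\<And>t r. r > 0 \<Longrightarrow> \<bar>\<psi> (t, r)\<bar> \<le> M * r"
    by (rule test_C1c_cases[OF C1c]) (use zero in blast)
  then interpret radial_test_function \<psi> \<psi>t \<psi>r T b M 0 by simp
  have "radial_test_function \<psi> \<psi>t \<psi>r T b M 1"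
  proof
    show "\<bar>\<psi> (t, r)\<bar> \<le> M * r powr 1" if "r > 0" for t r
      using linear[OF that] that by simp
  qed (use deriv cont_partials support bound_partials in auto)
  then show thesis by (rule that)
qed

section \<open>Self-similar balance laws\<close>

text \<open>Integrability of the derivative is automatic here: the Bochner integral of a non-integrable
function is 0 as well.\<close>

lemma integral_deriv_compact_support_eq_0:
  fixes w w' :: "real \<Rightarrow> real"
  assumes N: "finite N" and w: "continuous_on UNIV w"
    and d: "\<And>x. x \<notin> N \<Longrightarrow> (w has_real_derivative w' x) (at x)"
    and X: "\<And>x. X < \<bar>x\<bar> \<Longrightarrow> w x = 0" "\<And>x. X < \<bar>x\<bar> \<Longrightarrow> w' x = 0"
  shows "integral\<^sup>L lborel w' = 0"
proof (cases "integrable lborel w'")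
  case True
  define Y where "Y = \<bar>X\<bar> + 1"
  have "(w' has_integral w Y - w (- Y)) {- Y..Y}"
  proof (rule fundamental_theorem_of_calculus_interior_strong[OF N])
    show "- Y \<le> Y" unfolding Y_def by simp
    show "(w has_vector_derivative w' x) (at x)" if "x \<in> {- Y<..<Y} - N" for x
      using d that by (auto simp: has_real_derivative_iff_has_vector_derivative)
    show "continuous_on {- Y..Y} w"
      using w continuous_on_subset by blast
  qed
  moreover have "w Y = 0" "w (- Y) = 0"
    unfolding Y_def by (intro X(1); linarith)+
  ultimately have "(w' has_integral 0) {- Y..Y}" by simp
  then have "(w' has_integral 0) UNIV"
  proof (rule has_integral_on_superset)
    show "w' x = 0" if "x \<notin> {- Y..Y}" for x
      using that unfolding Y_def by (intro X(2)) auto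
  qed simp
  with has_integral_integral_real[OF True] show ?thesis
    by (rule has_integral_unique)
qed (rule not_integrable_integral_eq)

lemma integrable_box:
  fixes \<phi> :: "real \<Rightarrow> real" and P :: "real \<times> real \<Rightarrow> real"
  assumes [measurable]: "\<phi> \<in> borel_measurable borel" and \<phi>: "\<And>x. \<bar>\<phi> x\<bar> \<le> K"
    and P: "continuous_on half_plane P" and \<delta>: "\<delta> > 0"
    and supp: "\<And>x r. \<delta> \<le> r \<Longrightarrow> X < \<bar>x\<bar> \<or> b < r \<Longrightarrow> P (x, r) = 0"
  shows "integrable lborel (\<lambda>(x, r). indicator {\<delta>..} r * (\<phi> x * P (x, r)))"
proof -
  let ?S = "{- X..X} \<times> {\<delta>..b}"
  have P_int: "integrable lborel (\<lambda>z. indicator ?S z *\<^sub>R P z)"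
    using \<delta> by (intro borel_integrable_compact compact_Times continuous_on_subset[OF P]) auto
  have [measurable]: "(\<lambda>z. \<phi> (fst z)) \<in> borel_measurable (borel :: (real \<times> real) measure)"
    by (simp add: borel_prod[symmetric])
  have "integrable lborel (\<lambda>z. \<phi> (fst z) * (indicator ?S z *\<^sub>R P z))"
  proof (rule Bochner_Integration.integrable_bound)
    show "integrable lborel (\<lambda>z. K * (indicator ?S z *\<^sub>R P z))"
      using P_int by simp
    show "(\<lambda>z. \<phi> (fst z) * (indicator ?S z *\<^sub>R P z)) \<in> borel_measurable lborel"
      using borel_measurable_integrable[OF P_int] by measurable
    show "AE z in lborel. norm (\<phi> (fst z) * (indicator ?S z *\<^sub>R P z)) \<le> norm (K * (indicator ?S z *\<^sub>R P z))"
    proof (rule AE_I2)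
      fix z :: "real \<times> real"
      have "\<bar>\<phi> (fst z)\<bar> \<le> \<bar>K\<bar>" using \<phi>[of "fst z"] by linarith
      then show "norm (\<phi> (fst z) * (indicator ?S z *\<^sub>R P z)) \<le> norm (K * (indicator ?S z *\<^sub>R P z))"
        by (simp add: abs_mult mult_right_mono)
    qed
  qed
  moreover have "P (x, r) = 0 \<or> (- X \<le> x \<and> x \<le> X \<and> r \<le> b)" if "\<delta> \<le> r" for x r
    using supp[OF that, of x] by linarith
  then have "\<phi> (fst z) * (indicator ?S z *\<^sub>R P z) = (case z of (x, r) \<Rightarrow> indicator {\<delta>..} r * (\<phi> x * P (x, r)))"
    for z
    by (cases z) (force simp: indicator_def)
  ultimately show ?thesis by simp
qed

text \<open>The law \<open>q\<^sub>t + f\<^sub>r = s\<close> with \<open>q = r\<^bsup>a\<^esup> Q(x)\<close>, \<open>f = r\<^bsup>a + 1 - \<lambda>\<^esup> F(x)\<close>, \<open>s = r\<^bsup>a - \<lambda>\<^esup> S(x)\<close> and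
\<open>x = t / r\<^bsup>\<lambda>\<^esup>\<close>. The set N contains the values of x at the shocks. Away from them the law is the
equation for \<open>Q - \<lambda> x F\<close>, and across them the Rankine-Hugoniot condition says that \<open>Q - \<lambda> x F\<close>
does not jump. The values of the profiles at the shocks are
bounded but otherwise arbitrary.\<close>

locale self_similar_balance_law =
  fixes Q F S :: "real \<Rightarrow> real" and N :: "real set" and a lam \<theta> K :: real
  assumes lam_pos: "lam > 0" and theta_less_1: "\<theta> < 1" and a_gt: "a > -1"
    and profile_measurable [measurable]: "Q \<in> borel_measurable borel" "F \<in> borel_measurable borel"
      "S \<in> borel_measurable borel"
    and profile_bound: "\<And>x. \<bar>Q x\<bar> \<le> K" "\<And>x. \<bar>F x\<bar> \<le> K" "\<And>x. \<bar>S x\<bar> \<le> K"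
    and profile_decay: "\<And>x. x \<noteq> 0 \<Longrightarrow> \<bar>F x\<bar> \<le> K * \<bar>x\<bar> powr (-\<theta>)"
      "\<And>x. x \<noteq> 0 \<Longrightarrow> \<bar>S x\<bar> \<le> K * \<bar>x\<bar> powr (-\<theta>)"
    and finite_N: "finite N"
    and jump: "\<And>k. k \<in> N \<Longrightarrow> \<exists>v. ((\<lambda>x. Q x - lam * x * F x) \<longlongrightarrow> v) (at k)"
    and ODE: "\<And>x. x \<notin> N \<Longrightarrow>
      ((\<lambda>x. Q x - lam * x * F x) has_real_derivative S x - (a + 1) * F x) (at x)"
begin

text \<open>The continuous version of \<open>Q - \<lambda> x F\<close>, which replaces the arbitrary values at the shocks by the limits.\<close>

definition H :: "real \<Rightarrow> real" where "H x = Lim (at x) (\<lambda>x. Q x - lam * x * F x)"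

lemma H_eq: "x \<notin> N \<Longrightarrow> H x = Q x - lam * x * F x"
  unfolding H_def using DERIV_isCont[OF ODE, of x]
  by (intro tendsto_Lim) (auto simp: isCont_def)

lemma H_limit: "((\<lambda>x. Q x - lam * x * F x) \<longlongrightarrow> H x) (at x)"
proof (cases "x \<in> N")
  case True
  then show ?thesis using jump[OF True] tendsto_Lim[OF trivial_limit_at] unfolding H_def by blast
next
  case False
  then show ?thesis using DERIV_isCont[OF ODE[OF False]] H_eq[OF False] by (simp add: isCont_def)
qed

lemma H_cont: "continuous_on UNIV H"
proof -
  have "(H \<longlongrightarrow> H x) (at x)" for x
  proof (rule Lim_transform_eventually[OF H_limit])
    have "open (- (N - {x}))" using finite_N by (intro open_Compl finite_imp_closed) auto
    then have "eventually (\<lambda>y. y \<in> - (N - {x})) (at x)"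
      by (rule eventually_at_in_open') simp
    then show "eventually (\<lambda>y. Q y - lam * y * F y = H y) (at x)"
      using eventually_neq_at_within by eventually_elim (auto simp: H_eq)
  qed
  then show ?thesis by (auto simp: continuous_on_def intro: tendsto_within_subset)
qed

lemma H_deriv:
  assumes "x \<notin> N"
  shows "(H has_real_derivative S x - (a + 1) * F x) (at x)"
proof (rule has_field_derivative_transform_within_open[OF ODE[OF assms]])
  show "open (- N)" using finite_N by (intro open_Compl finite_imp_closed)
qed (use assms H_eq in auto)

text \<open>The decay of F at infinity improves the power of r in the flux from \<open>a + 1 - \<lambda>\<close> to \<open>\<beta>\<close>, at the
price of a factor \<open>\<bar>t\<bar>\<^bsup>-\<theta>\<^esup>\<close>.\<close>

definition \<beta> :: real where "\<beta> = a + 1 - lam + lam * \<theta>"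

lemma K_nonneg: "K \<ge> 0"
  using profile_bound(1)[of 0] by linarith

lemma decay_powr:
  assumes "r > 0" "t \<noteq> 0" "\<bar>f\<bar> \<le> K * \<bar>t / r powr lam\<bar> powr (-\<theta>)"
  shows "r powr s * \<bar>f\<bar> \<le> K * (\<bar>t\<bar> powr (-\<theta>) * r powr (s + lam * \<theta>))"
proof -
  have "r powr s * \<bar>f\<bar> \<le> r powr s * (K * \<bar>t / r powr lam\<bar> powr (-\<theta>))"
    using assms(3) by (intro mult_left_mono) auto
  also have "\<bar>t / r powr lam\<bar> powr (-\<theta>) = \<bar>t\<bar> powr (-\<theta>) * r powr (lam * \<theta>)"
    using assms by (simp add: abs_divide powr_divide powr_powr powr_minus_divide)
  finally show ?thesis by (simp add: powr_add mult_ac)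
qed

end

text \<open>The flux times the test function is of the order of \<open>r\<^bsup>\<beta> + j\<^esup>\<close> after integration in time, so the
last assumption says that nothing flows through the centre.\<close>

locale tested_self_similar_balance_law =
  self_similar_balance_law Q F S N a lam \<theta> K + radial_test_function \<psi> \<psi>t \<psi>r T b M j
  for Q F S N a lam \<theta> K \<psi> \<psi>t \<psi>r T b M j +
  assumes beta: "\<beta> + j > 0"
begin

definition weak_integrand :: "real \<times> real \<Rightarrow> real" where
  "weak_integrand = (\<lambda>(t, r). r powr a * Q (t / r powr lam) * \<psi>t (t, r)
     + r powr (a + 1 - lam) * F (t / r powr lam) * \<psi>r (t, r)
     + r powr (a - lam) * S (t / r powr lam) * \<psi> (t, r))"

lemma test_measurable [measurable]:
  "(\<lambda>z. indicator half_plane z * \<psi> z) \<in> borel_measurable borel"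
  "(\<lambda>z. indicator half_plane z * \<psi>t z) \<in> borel_measurable borel"
  "(\<lambda>z. indicator half_plane z * \<psi>r z) \<in> borel_measurable borel"
proof -
  have "half_plane \<in> sets borel" by (intro borel_open open_Times) auto
  note * = borel_measurable_continuous_on_indicator[OF this]
  show "(\<lambda>z. indicator half_plane z * \<psi> z) \<in> borel_measurable borel"
    using *[OF cont] unfolding real_scaleR_def .
  show "(\<lambda>z. indicator half_plane z * \<psi>t z) \<in> borel_measurable borel"
    using *[OF cont_partials(1)] unfolding real_scaleR_def .
  show "(\<lambda>z. indicator half_plane z * \<psi>r z) \<in> borel_measurable borel"
    using *[OF cont_partials(2)] unfolding real_scaleR_def .
qed

lemma weak_integrand_measurable: "(\<lambda>z. indicator half_plane z * weak_integrand z) \<in> borel_measurable borel"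
proof -
  note [measurable] = self_similar_measurable[OF profile_measurable(1), of a lam]
    self_similar_measurable[OF profile_measurable(2), of "a + 1 - lam" lam]
    self_similar_measurable[OF profile_measurable(3), of "a - lam" lam]
  have "(\<lambda>z. indicator half_plane z * weak_integrand z) = (\<lambda>z.
     (case z of (t, r) \<Rightarrow> r powr a * Q (t / r powr lam)) * (indicator half_plane z * \<psi>t z)
     + (case z of (t, r) \<Rightarrow> r powr (a + 1 - lam) * F (t / r powr lam)) * (indicator half_plane z * \<psi>r z)
     + (case z of (t, r) \<Rightarrow> r powr (a - lam) * S (t / r powr lam)) * (indicator half_plane z * \<psi> z))"
    by (rule ext) (auto simp: weak_integrand_def algebra_simps)
  also have "\<dots> \<in> borel_measurable borel" by measurable
  finally show ?thesis .
qed

lemma weak_integrand_bound: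
  assumes "r > 0" "t \<noteq> 0"
  shows "\<bar>weak_integrand (t, r)\<bar> \<le> (K * M) * ((indicator {-T..T} t * \<bar>t\<bar> powr (-0)) * (indicator {0<..b} r * r powr a))
    + (K * M) * ((indicator {-T..T} t * \<bar>t\<bar> powr (-\<theta>)) * (indicator {0<..b} r * r powr \<beta>))
    + (K * M) * ((indicator {-T..T} t * \<bar>t\<bar> powr (-\<theta>)) * (indicator {0<..b} r * r powr (\<beta> + j - 1)))"
proof (cases "\<bar>t\<bar> \<le> T \<and> r \<le> b")
  case True
  let ?x = "t / r powr lam"
  have x: "?x \<noteq> 0" using assms by simp
  have "\<bar>r powr a * Q ?x * \<psi>t (t, r)\<bar> = (r powr a * \<bar>Q ?x\<bar>) * \<bar>\<psi>t (t, r)\<bar>"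
    by (simp add: abs_mult)
  also have "\<dots> \<le> (r powr a * K) * M"
    using assms profile_bound(1) bound_partials K_nonneg by (intro mult_mono mult_left_mono) auto
  finally have 1: "\<bar>r powr a * Q ?x * \<psi>t (t, r)\<bar> \<le> K * M * r powr a" by (simp add: mult_ac)
  have "\<bar>r powr (a + 1 - lam) * F ?x * \<psi>r (t, r)\<bar> = (r powr (a + 1 - lam) * \<bar>F ?x\<bar>) * \<bar>\<psi>r (t, r)\<bar>"
    by (simp add: abs_mult)
  also have "\<dots> \<le> (K * (\<bar>t\<bar> powr (-\<theta>) * r powr \<beta>)) * M"
    unfolding \<beta>_def
    by (rule mult_mono[OF decay_powr[OF assms profile_decay(1)[OF x]] bound_partials(2)[OF assms(1)]])
       (use K_nonneg in auto)
  finally have 2: "\<bar>r powr (a + 1 - lam) * F ?x * \<psi>r (t, r)\<bar> \<le> K * M * (\<bar>t\<bar> powr (-\<theta>) * r powr \<beta>)"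
    by (simp add: mult_ac)
  have "\<bar>r powr (a - lam) * S ?x * \<psi> (t, r)\<bar> = (r powr (a - lam) * \<bar>S ?x\<bar>) * \<bar>\<psi> (t, r)\<bar>"
    by (simp add: abs_mult)
  also have "\<dots> \<le> (K * (\<bar>t\<bar> powr (-\<theta>) * r powr (a - lam + lam * \<theta>))) * (M * r powr j)"
    by (rule mult_mono[OF decay_powr[OF assms profile_decay(2)[OF x]] bound[OF assms(1)]])
       (use K_nonneg in auto)
  also have "\<dots> = K * M * (\<bar>t\<bar> powr (-\<theta>) * (r powr (a - lam + lam * \<theta>) * r powr j))"
    by (simp add: mult_ac)
  also have "r powr (a - lam + lam * \<theta>) * r powr j = r powr (\<beta> + j - 1)"
    unfolding powr_add[symmetric] \<beta>_def by (simp add: algebra_simps)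
  finally have 3: "\<bar>r powr (a - lam) * S ?x * \<psi> (t, r)\<bar> \<le> K * M * (\<bar>t\<bar> powr (-\<theta>) * r powr (\<beta> + j - 1))" .
  have "\<bar>weak_integrand (t, r)\<bar> \<le> \<bar>r powr a * Q ?x * \<psi>t (t, r)\<bar> + \<bar>r powr (a + 1 - lam) * F ?x * \<psi>r (t, r)\<bar>
    + \<bar>r powr (a - lam) * S ?x * \<psi> (t, r)\<bar>"
    unfolding weak_integrand_def by simp
  also have "\<dots> \<le> K * M * r powr a + K * M * (\<bar>t\<bar> powr (-\<theta>) * r powr \<beta>)
    + K * M * (\<bar>t\<bar> powr (-\<theta>) * r powr (\<beta> + j - 1))"
    using 1 2 3 by linarith
  finally show ?thesis using True assms by (simp add: abs_le_iff)
next
  case False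
  then have "T < \<bar>t\<bar> \<or> b < r" by linarith
  from support[OF assms(1) this] have "weak_integrand (t, r) = 0" by (simp add: weak_integrand_def)
  with K_nonneg M_nonneg show ?thesis by simp
qed

lemma weak_integrand_integrable: "integrable lborel (\<lambda>z. indicator half_plane z * weak_integrand z)"
proof (rule Bochner_Integration.integrable_bound)
  let ?W = "\<lambda>\<theta> k. \<lambda>(t, r). (indicator {-T..T} t * \<bar>t\<bar> powr (-\<theta>)) * (indicator {0<..b} r * r powr k) :: real"
  have W: "integrable lborel (?W 0 a)" "integrable lborel (?W \<theta> \<beta>)" "integrable lborel (?W \<theta> (\<beta> + j - 1))"
    using a_gt theta_less_1 beta j_le_1 by (intro integrable_power_weight; simp)+
  show "integrable lborel (\<lambda>z. K * M * ?W 0 a z + K * M * ?W \<theta> \<beta> z + K * M * ?W \<theta> (\<beta> + j - 1) z)"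
    using W by simp
  show "(\<lambda>z. indicator half_plane z * weak_integrand z) \<in> borel_measurable lborel"
    using weak_integrand_measurable by simp
  show "AE z in lborel. norm (indicator half_plane z * weak_integrand z)
    \<le> norm (K * M * ?W 0 a z + K * M * ?W \<theta> \<beta> z + K * M * ?W \<theta> (\<beta> + j - 1) z)"
    using AE_time_nonzero
  proof eventually_elim
    case (elim z)
    show ?case
    proof (cases "snd z > 0")
      case True
      with elim weak_integrand_bound[of "snd z" "fst z"] show ?thesis
        by (cases z) (auto intro: order_trans[OF _ abs_ge_self])
    qed (cases z; simp)
  qed
qed

text \<open>Let \<open>\<Psi>(x, r)\<close> be \<open>\<psi>\<close> at radius r and similarity coordinate x. Times the Jacobian of
\<open>t \<mapsto> x\<close>, the integrand is \<open>r\<^bsup>a\<^esup> \<partial>\<^sub>x(H \<Psi>) + F \<partial>\<^sub>r(r\<^bsup>a + 1\<^esup> \<Psi>)\<close>: the factor H carries no derivative in r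
and the factor F carries none in x. So each summand is integrated first in the variable of its
derivative, and only the flux through \<open>r = \<delta>\<close> remains.\<close>

lemma integral_truncated:
  assumes \<delta>: "\<delta> > 0"
  shows "(\<integral>z. indicator (UNIV \<times> {\<delta>..}) z * weak_integrand z \<partial>lborel)
    = - (\<delta> powr (a + 1 - lam) * (\<integral>t. F (t / \<delta> powr lam) * \<psi> (t, \<delta>) \<partial>lborel))"
proof -
  define X where "X = T / \<delta> powr lam"
  \<comment> \<open>For fixed radius at least \<open>\<delta>\<close>, the test function vanishes for \<open>\<bar>x\<bar> > X\<close>.\<close>
  have outside: "T < \<bar>x * r powr lam\<bar> \<or> b < r" if "\<delta> \<le> r" "X < \<bar>x\<bar> \<or> b < r" for x r
  proof (cases "b < r")
    case False
    with that have "T < \<bar>x\<bar> * \<delta> powr lam"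
      using \<delta> by (simp add: X_def divide_less_eq)
    also have "\<dots> \<le> \<bar>x\<bar> * r powr lam"
      using that \<delta> lam_pos by (intro mult_left_mono powr_mono2) auto
    finally show ?thesis by (simp add: abs_mult)
  qed simp
  have zero: "\<psi> (x * r powr lam, r) = 0 \<and> \<psi>t (x * r powr lam, r) = 0 \<and> \<psi>r (x * r powr lam, r) = 0"
    if "\<delta> \<le> r" "X < \<bar>x\<bar> \<or> b < r" for x r
    using support[OF _ outside[OF that]] that \<delta> by auto
  have comp: "continuous_on half_plane (\<lambda>(x, r). f (x * r powr lam, r))"
    if "continuous_on half_plane f" for f :: "real \<times> real \<Rightarrow> real"
    unfolding case_prod_unfold
    by (rule continuous_on_compose2[OF that]) (auto intro!: continuous_intros)
  define P1 where "P1 = (\<lambda>(x, r). r powr (a + lam) * \<psi>t (x * r powr lam, r))"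
  define P2 where "P2 = (\<lambda>(x, r). - (lam * x * r powr (a + lam) * \<psi>t (x * r powr lam, r))
    - (a + 1) * r powr a * \<psi> (x * r powr lam, r))"
  define P3 where "P3 = (\<lambda>(x, r). r powr a * \<psi> (x * r powr lam, r))"
  define P4 where "P4 = (\<lambda>(x, r). (a + 1) * r powr a * \<psi> (x * r powr lam, r)
    + r powr (a + 1) * (\<psi>t (x * r powr lam, r) * (x * (lam * r powr (lam - 1))) + \<psi>r (x * r powr lam, r)))"
  note c\<psi> = comp[OF cont, unfolded case_prod_unfold]
    comp[OF cont_partials(1), unfolded case_prod_unfold] comp[OF cont_partials(2), unfolded case_prod_unfold]
  have cP1: "continuous_on half_plane P1"
    unfolding P1_def case_prod_unfold by (intro continuous_intros c\<psi>) auto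
  have cP2: "continuous_on half_plane P2"
    unfolding P2_def case_prod_unfold by (intro continuous_intros c\<psi>) auto
  have cP3: "continuous_on half_plane P3"
    unfolding P3_def case_prod_unfold by (intro continuous_intros c\<psi>) auto
  have cP4: "continuous_on half_plane P4"
    unfolding P4_def case_prod_unfold by (intro continuous_intros c\<psi>) auto
  let ?i = "\<lambda>r. indicator {\<delta>..} r :: real"
  \<comment> \<open>On \<open>r \<ge> \<delta>\<close>, A1 is \<open>r\<^bsup>a\<^esup> \<partial>\<^sub>x(H \<Psi>)\<close> and A2 is \<open>F \<partial>\<^sub>r(r\<^bsup>a + 1\<^esup> \<Psi>)\<close>.\<close>
  define A1 where "A1 x r = ?i r * (Q x * P1 (x, r)) + ?i r * (F x * P2 (x, r)) + ?i r * (S x * P3 (x, r))" for x r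
  define A2 where "A2 x r = ?i r * (F x * P4 (x, r))" for x r
  have A1_int: "integrable (lborel \<Otimes>\<^sub>M lborel) (case_prod A1)"
    using integrable_box[OF profile_measurable(1) profile_bound(1) cP1 \<delta>, of X b]
      integrable_box[OF profile_measurable(2) profile_bound(2) cP2 \<delta>, of X b]
      integrable_box[OF profile_measurable(3) profile_bound(3) cP3 \<delta>, of X b] zero
    unfolding A1_def case_prod_unfold P1_def P2_def P3_def lborel_prod
    by (intro Bochner_Integration.integrable_add) auto
  have A2_int: "integrable (lborel \<Otimes>\<^sub>M lborel) (case_prod A2)"
    using integrable_box[OF profile_measurable(2) profile_bound(2) cP4 \<delta>, of X b] zero
    unfolding A2_def case_prod_unfold P4_def lborel_prod by auto
  have A1_zero: "(\<integral>x. A1 x r \<partial>lborel) = 0" for r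
  proof (cases "\<delta> \<le> r")
    case True
    then have r: "r > 0" using \<delta> by simp
    show ?thesis
    proof (rule integral_deriv_compact_support_eq_0[OF finite_N])
      have \<psi>_deriv: "((\<lambda>x. \<psi> (x * r powr lam, r)) has_real_derivative \<psi>t (x * r powr lam, r) * r powr lam) (at x)" for x
      proof -
        have "((\<lambda>x. x * r powr lam) has_real_derivative r powr lam) (at x)"
          "((\<lambda>x. r) has_real_derivative 0) (at x)"
          by (auto intro!: derivative_eq_intros)
        from deriv_along[OF this r] show ?thesis by simp
      qed
      have \<psi>_cont: "continuous_on UNIV (\<lambda>x. \<psi> (x * r powr lam, r))"
        by (rule DERIV_continuous_on) (use \<psi>_deriv in \<open>auto intro: has_field_derivative_at_within\<close>)
      show "continuous_on UNIV (\<lambda>x. r powr a * (H x * \<psi> (x * r powr lam, r)))"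
        by (intro continuous_intros H_cont \<psi>_cont)
      show "((\<lambda>x. r powr a * (H x * \<psi> (x * r powr lam, r))) has_real_derivative A1 x r) (at x)"
        if "x \<notin> N" for x
      proof -
        have Q_eq: "Q x = H x + lam * x * F x" using H_eq[OF that] by simp
        show ?thesis
          by (rule derivative_eq_intros H_deriv[OF that] \<psi>_deriv refl)+
            (use True in \<open>simp add: A1_def P1_def P2_def P3_def Q_eq algebra_simps powr_add\<close>)
      qed
      show "r powr a * (H x * \<psi> (x * r powr lam, r)) = 0" if "X < \<bar>x\<bar>" for x
        using zero[OF True] that by simp
      show "A1 x r = 0" if "X < \<bar>x\<bar>" for x
        using zero[OF True] that by (simp add: A1_def P1_def P2_def P3_def)
    qed
  qed (simp add: A1_def)
  have A2_eq: "(\<integral>r. A2 x r \<partial>lborel) = - (\<delta> powr (a + 1) * (F x * \<psi> (x * \<delta> powr lam, \<delta>)))" for x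
  proof -
    define b' where "b' = max \<delta> b + 1"
    have b': "\<delta> < b'" "b < b'" unfolding b'_def by auto
    define w where "w r = r powr (a + 1) * \<psi> (x * r powr lam, r)" for r
    have w: "(w has_real_derivative P4 (x, r)) (at r)" if "r > 0" for r
    proof -
      have "((\<lambda>r. x * r powr lam) has_real_derivative x * (lam * r powr (lam - 1))) (at r)"
        "((\<lambda>r. r) has_real_derivative 1) (at r)"
        using that by (auto intro!: derivative_eq_intros)
      from deriv_along[OF this that]
      have *: "((\<lambda>r. \<psi> (x * r powr lam, r)) has_real_derivative
        \<psi>t (x * r powr lam, r) * (x * (lam * r powr (lam - 1))) + \<psi>r (x * r powr lam, r) * 1) (at r)" .
      have "((\<lambda>r. r powr (a + 1)) has_real_derivative (a + 1) * r powr a) (at r)"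
        using that by (auto intro!: derivative_eq_intros)
      from DERIV_mult[OF this *] show ?thesis
        unfolding w_def P4_def by (rule DERIV_cong) (simp add: algebra_simps)
    qed
    have "(\<integral>r. A2 x r \<partial>lborel) = F x * (\<integral>r. ?i r * P4 (x, r) \<partial>lborel)"
      unfolding A2_def by (subst integral_mult_right_zero[symmetric]) (simp add: mult_ac)
    also have "(\<lambda>r. ?i r * P4 (x, r)) = (\<lambda>r. indicator {\<delta>..b'} r *\<^sub>R P4 (x, r))"
    proof
      fix r
      show "?i r * P4 (x, r) = indicator {\<delta>..b'} r *\<^sub>R P4 (x, r)"
        using zero[of r x] b' by (cases "b < r") (auto simp: indicator_def P4_def)
    qed
    also have "(\<integral>r. indicator {\<delta>..b'} r *\<^sub>R P4 (x, r) \<partial>lborel) = w b' - w \<delta>"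
    proof (rule integral_FTC_atLeastAtMost)
      show "\<delta> \<le> b'" using b' by simp
      show "(w has_vector_derivative P4 (x, r)) (at r within {\<delta>..b'})" if "\<delta> \<le> r" "r \<le> b'" for r
        using w[of r] \<delta> that
        by (auto simp: has_real_derivative_iff_has_vector_derivative intro: has_vector_derivative_at_within)
      show "continuous_on {\<delta>..b'} (\<lambda>r. P4 (x, r))"
        by (rule continuous_on_compose2[OF cP4]) (use \<delta> in \<open>auto intro!: continuous_intros\<close>)
    qed
    also have "w b' = 0" using zero[of b' x] b' by (simp add: w_def)
    finally show ?thesis by (simp add: w_def)
  qed
  have cut: "integrable lborel (\<lambda>z. indicator (UNIV \<times> {\<delta>..}) z * weak_integrand z)"
  proof -
    have [measurable]: "UNIV \<times> {\<delta>..} \<in> sets (borel :: (real \<times> real) measure)" by (intro borel_closed closed_Times) auto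
    have "indicator (UNIV \<times> {\<delta>..}) z * weak_integrand z = indicator (UNIV \<times> {\<delta>..}) z *\<^sub>R (indicator half_plane z * weak_integrand z)" for z
      using \<delta> by (auto simp: indicator_def)
    then show ?thesis
      using Bochner_Integration.integrable_mult_indicator[OF _ weak_integrand_integrable, of "UNIV \<times> {\<delta>..}"]
      by (simp only:) simp
  qed
  have split: "(\<integral>t. ?i r * weak_integrand (t, r) \<partial>lborel) = (\<integral>x. A1 x r + A2 x r \<partial>lborel)" for r
  proof (cases "\<delta> \<le> r")
    case True
    then have r: "r > 0" using \<delta> by simp
    have "(\<integral>t. weak_integrand (t, r) \<partial>lborel) = r powr lam * (\<integral>x. weak_integrand (0 + r powr lam * x, r) \<partial>lborel)"
      using r by (subst lborel_integral_real_affine[of "r powr lam" _ 0]) auto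
    also have "\<dots> = (\<integral>x. r powr lam * weak_integrand (x * r powr lam, r) \<partial>lborel)"
      by (simp add: mult.commute)
    also have "(\<lambda>x. r powr lam * weak_integrand (x * r powr lam, r)) = (\<lambda>x. A1 x r + A2 x r)"
    proof
      fix x
      have p: "r powr lam * r powr (a + 1 - lam) = r powr (a + 1)" "r powr lam * r powr (a - lam) = r powr a"
        "r powr lam * r powr a = r powr (a + lam)" "r powr (a + 1) * r powr (lam - 1) = r powr (a + lam)"
        by (simp_all flip: powr_add add: algebra_simps)
      have "r powr lam * weak_integrand (x * r powr lam, r) = (r powr lam * r powr a) * (Q x * \<psi>t (x * r powr lam, r))
        + (r powr lam * r powr (a + 1 - lam)) * (F x * \<psi>r (x * r powr lam, r))
        + (r powr lam * r powr (a - lam)) * (S x * \<psi> (x * r powr lam, r))"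
        using r by (simp add: weak_integrand_def algebra_simps)
      also have "\<dots> = A1 x r + A2 x r"
        using True unfolding p by (simp add: A1_def A2_def P1_def P2_def P3_def P4_def algebra_simps flip: p(4))
      finally show "r powr lam * weak_integrand (x * r powr lam, r) = A1 x r + A2 x r" .
    qed
    finally show ?thesis using True by simp
  qed (simp add: A1_def A2_def)
  have "(\<integral>z. indicator (UNIV \<times> {\<delta>..}) z * weak_integrand z \<partial>lborel)
    = integral\<^sup>L (lborel \<Otimes>\<^sub>M lborel) (\<lambda>(t, r). ?i r * weak_integrand (t, r))"
    by (simp add: lborel_prod case_prod_unfold indicator_def mem_Times_iff)
  also have "\<dots> = (\<integral>r. (\<integral>t. ?i r * weak_integrand (t, r) \<partial>lborel) \<partial>lborel)"
    using cut by (intro lborel_pair.integral_snd[symmetric])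
      (simp add: lborel_prod case_prod_unfold indicator_def mem_Times_iff)
  also have "\<dots> = integral\<^sup>L (lborel \<Otimes>\<^sub>M lborel) (\<lambda>(x, r). A1 x r + A2 x r)"
    unfolding split using A1_int A2_int
    by (intro lborel_pair.integral_snd) (simp add: case_prod_unfold)
  also have "\<dots> = integral\<^sup>L (lborel \<Otimes>\<^sub>M lborel) (case_prod A1) + integral\<^sup>L (lborel \<Otimes>\<^sub>M lborel) (case_prod A2)"
    using A1_int A2_int by (simp add: case_prod_unfold)
  also have "\<dots> = (\<integral>r. (\<integral>x. A1 x r \<partial>lborel) \<partial>lborel) + (\<integral>x. (\<integral>r. A2 x r \<partial>lborel) \<partial>lborel)"
    using lborel_pair.integral_snd[OF A1_int] lborel_pair.integral_fst[OF A2_int] by simp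
  also have "\<dots> = - (\<delta> powr (a + 1) * (\<integral>x. F x * \<psi> (x * \<delta> powr lam, \<delta>) \<partial>lborel))"
    unfolding A1_zero A2_eq by simp
  also have "(\<integral>t. F (t / \<delta> powr lam) * \<psi> (t, \<delta>) \<partial>lborel)
    = \<delta> powr lam * (\<integral>x. F x * \<psi> (x * \<delta> powr lam, \<delta>) \<partial>lborel)"
    using \<delta> by (subst lborel_integral_real_affine[of "\<delta> powr lam" _ 0]) (auto simp: mult.commute)
  then have "\<delta> powr (a + 1) * (\<integral>x. F x * \<psi> (x * \<delta> powr lam, \<delta>) \<partial>lborel)
    = \<delta> powr (a + 1 - lam) * (\<integral>t. F (t / \<delta> powr lam) * \<psi> (t, \<delta>) \<partial>lborel)"
    by (simp flip: powr_add mult.assoc)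
  finally show ?thesis .
qed

lemma flux_bound:
  assumes \<delta>: "\<delta> > 0"
  shows "\<bar>\<delta> powr (a + 1 - lam) * (\<integral>t. F (t / \<delta> powr lam) * \<psi> (t, \<delta>) \<partial>lborel)\<bar>
    \<le> \<delta> powr (\<beta> + j) * (K * M * (\<integral>t. indicator {-T..T} t * \<bar>t\<bar> powr (-\<theta>) \<partial>lborel))"
proof -
  let ?w = "\<lambda>t. \<delta> powr (\<beta> + j) * (K * M * (indicator {-T..T} t * \<bar>t\<bar> powr (-\<theta>)))"
  let ?f = "\<lambda>t. \<delta> powr (a + 1 - lam) * (F (t / \<delta> powr lam) * \<psi> (t, \<delta>))"
  have "\<bar>\<integral>t. ?f t \<partial>lborel\<bar> \<le> (\<integral>t. \<bar>?f t\<bar> \<partial>lborel)"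
    using integral_norm_bound[of lborel ?f] by simp
  also have "\<dots> \<le> (\<integral>t. ?w t \<partial>lborel)"
  proof (rule integral_mono_AE')
    show "integrable lborel ?w"
      using integrable_abs_powr[OF theta_less_1, of T] by simp
    show "AE t in lborel. \<bar>?f t\<bar> \<le> ?w t"
      using AE_lborel_singleton[of 0]
    proof eventually_elim
      case (elim t)
      show ?case
      proof (cases "T < \<bar>t\<bar>")
        case True
        with support[OF \<delta>, of t] K_nonneg M_nonneg show ?thesis by simp
      next
        case False
        have "t / \<delta> powr lam \<noteq> 0" using elim \<delta> by simp
        from decay_powr[OF \<delta> _ profile_decay(1)[OF this], of "a + 1 - lam"] elim
        have *: "\<delta> powr (a + 1 - lam) * \<bar>F (t / \<delta> powr lam)\<bar> \<le> K * (\<bar>t\<bar> powr (-\<theta>) * \<delta> powr \<beta>)"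
          unfolding \<beta>_def by simp
        have "\<bar>?f t\<bar> = (\<delta> powr (a + 1 - lam) * \<bar>F (t / \<delta> powr lam)\<bar>) * \<bar>\<psi> (t, \<delta>)\<bar>"
          by (simp add: abs_mult)
        also have "\<dots> \<le> (K * (\<bar>t\<bar> powr (-\<theta>) * \<delta> powr \<beta>)) * (M * \<delta> powr j)"
          by (rule mult_mono[OF * bound[OF \<delta>]]) (use K_nonneg in auto)
        finally show ?thesis using False by (simp add: powr_add mult_ac abs_le_iff not_less)
      qed
    qed
    show "AE t in lborel. 0 \<le> ?w t" using K_nonneg M_nonneg by simp
  qed
  finally show ?thesis by simp
qed

text \<open>Truncate at \<open>r = \<delta>\<close> and let \<open>\<delta>\<close> tend to 0: the integrand is integrable and the flux tends to 0.\<close>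

lemma weak_balance_law: "has_bochner_integral (lebesgue_on half_plane) weak_integrand 0"
proof -
  have hp: "half_plane \<in> sets borel" by (intro borel_open open_Times) auto
  have hp': "half_plane \<inter> space lebesgue \<in> sets lebesgue"
    using hp by simp
  let ?\<delta> = "\<lambda>k::nat. inverse (real (Suc k))"
  let ?J = "\<lambda>\<delta>. \<integral>z. indicator (UNIV \<times> {\<delta>..}) z * weak_integrand z \<partial>lborel"
  have "(\<lambda>k. ?J (?\<delta> k)) \<longlonglongrightarrow> (\<integral>z. indicator half_plane z * weak_integrand z \<partial>lborel)"
  proof (rule integral_dominated_convergence)
    show "integrable lborel (\<lambda>z. \<bar>indicator half_plane z * weak_integrand z\<bar>)"
      using weak_integrand_integrable by (rule integrable_abs)
    show "(\<lambda>z. indicator half_plane z * weak_integrand z) \<in> borel_measurable lborel"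
      using weak_integrand_measurable by simp
    have eq: "indicator (UNIV \<times> {?\<delta> k..}) z * weak_integrand z
      = indicator (UNIV \<times> {?\<delta> k..}) z * (indicator half_plane z * weak_integrand z)" for k z
      by (cases z) (auto simp: indicator_def intro: less_le_trans[rotated])
    have [measurable]: "UNIV \<times> {?\<delta> k..} \<in> sets (borel :: (real \<times> real) measure)" for k
      by (intro borel_closed closed_Times) auto
    show "(\<lambda>z. indicator (UNIV \<times> {?\<delta> k..}) z * weak_integrand z) \<in> borel_measurable lborel" for k
      unfolding eq using weak_integrand_measurable by measurable
    show "AE z in lborel. norm (indicator (UNIV \<times> {?\<delta> k..}) z * weak_integrand z) \<le> \<bar>indicator half_plane z * weak_integrand z\<bar>" for k
      unfolding eq by (intro AE_I2) (simp add: indicator_def)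
    show "AE z in lborel. (\<lambda>k. indicator (UNIV \<times> {?\<delta> k..}) z * weak_integrand z) \<longlonglongrightarrow> indicator half_plane z * weak_integrand z"
    proof (rule AE_I2)
      fix z :: "real \<times> real"
      show "(\<lambda>k. indicator (UNIV \<times> {?\<delta> k..}) z * weak_integrand z) \<longlonglongrightarrow> indicator half_plane z * weak_integrand z"
      proof (cases "snd z > 0")
        case True
        have "?\<delta> \<longlonglongrightarrow> 0" by (rule LIMSEQ_inverse_real_of_nat)
        from order_tendstoD(2)[OF this True]
        have "eventually (\<lambda>k. indicator (UNIV \<times> {?\<delta> k..}) z * weak_integrand z = indicator half_plane z * weak_integrand z) sequentially"
          by eventually_elim (use True in \<open>cases z; simp\<close>)
        then show ?thesis by (rule tendsto_eventually)
      next
        case False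
        then show ?thesis unfolding eq by (cases z) simp
      qed
    qed
  qed
  moreover have "(\<lambda>k. ?J (?\<delta> k)) \<longlonglongrightarrow> 0"
  proof (rule tendsto_0_le[where K = 1])
    show "(\<lambda>k. ?\<delta> k powr (\<beta> + j) * (K * M * (\<integral>t. indicator {-T..T} t * \<bar>t\<bar> powr (-\<theta>) \<partial>lborel))) \<longlonglongrightarrow> 0"
      using beta
      by (intro tendsto_mult_left_zero tendsto_zero_powrI[OF LIMSEQ_inverse_real_of_nat tendsto_const]) auto
    show "\<forall>\<^sub>F k in sequentially. norm (?J (?\<delta> k)) \<le>
      norm (?\<delta> k powr (\<beta> + j) * (K * M * (\<integral>t. indicator {-T..T} t * \<bar>t\<bar> powr (-\<theta>) \<partial>lborel))) * 1"
      using flux_bound[of "?\<delta> _"]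
      by (intro always_eventually allI, subst integral_truncated)
        (auto intro: order_trans[OF _ abs_ge_self] simp del: of_nat_Suc)
  qed
  ultimately have "(\<integral>z. indicator half_plane z * weak_integrand z \<partial>lborel) = 0"
    by (rule LIMSEQ_unique)
  then have "integral\<^sup>L (lebesgue_on half_plane) weak_integrand = 0"
    using weak_integrand_measurable by (simp add: integral_restrict_space[OF hp'] integral_completion)
  moreover have "integrable (lebesgue_on half_plane) weak_integrand"
    using weak_integrand_measurable weak_integrand_integrable by (simp add: integrable_restrict_space[OF hp'] integrable_completion)
  ultimately show ?thesis by (simp add: has_bochner_integral_iff)
qed

end

section \<open>Facts about functions of one variable\<close>

lemma borel_measurable_isCont_off_finite:
  fixes f :: "real \<Rightarrow> real"
  assumes N: "finite N" and f: "\<And>x. x \<notin> N \<Longrightarrow> isCont f x"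
  shows "f \<in> borel_measurable borel"
proof (rule measurable_discrete_difference[where X = N])
  have "- N \<in> sets borel" "continuous_on (- N) f"
    using N f by (auto simp: finite_imp_closed intro!: borel_open open_Compl continuous_at_imp_continuous_on)
  from borel_measurable_continuous_on_indicator[OF this]
  show "(\<lambda>x. indicator (- N) x *\<^sub>R f x) \<in> borel_measurable borel" .
qed (use N in \<open>auto intro: countable_finite\<close>)

text \<open>The argument runs through the square of W, whose product with \<open>exp (\<plusminus> 2 M y)\<close> is monotone whatever
the sign of W; that W is positive then follows from the intermediate value theorem.\<close>

lemma linear_ODE_bounds:
  fixes W h :: "real \<Rightarrow> real"
  assumes px: "p < x"
    and d: "\<And>y. p < y \<Longrightarrow> y \<le> x \<Longrightarrow> (W has_real_derivative h y * W y) (at y)"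
    and h: "\<And>y. p < y \<Longrightarrow> y \<le> x \<Longrightarrow> \<bar>h y\<bar> \<le> M"
    and lim: "(W \<longlongrightarrow> w) (at_right p)" and w: "w > 0"
  shows "w * exp (- M * (x - p)) \<le> W x" and "W x \<le> w * exp (M * (x - p))"
proof -
  \<comment> \<open>The sign \<open>\<sigma>\<close> handles the lower bound (1) and the upper bound (-1) together.\<close>
  have mono: "(\<sigma> * w\<^sup>2) \<le> \<sigma> * (W y)\<^sup>2 * exp (\<sigma> * (2 * M * (y - p)))"
    if y: "p < y" "y \<le> x" and \<sigma>: "\<sigma> = 1 \<or> \<sigma> = -1" for y \<sigma> :: real
  proof -
    define Z where "Z z = \<sigma> * (W z)\<^sup>2 * exp (\<sigma> * (2 * M * (z - p)))" for z
    have Z: "(Z has_real_derivative 2 * (\<sigma> * h z + M) * (W z)\<^sup>2 * exp (\<sigma> * (2 * M * (z - p)))) (at z)"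
      if "p < z" "z \<le> y" for z
    proof -
      have "\<sigma> * \<sigma> = 1" using \<sigma> by auto
      then show ?thesis
        unfolding Z_def using that y
        by (auto intro!: derivative_eq_intros d simp: algebra_simps power2_eq_square)
    qed
    have Z_mono: "Z z \<le> Z y" if "p < z" "z \<le> y" for z
    proof (rule DERIV_nonneg_imp_nondecreasing[OF that(2)])
      fix v assume v: "z \<le> v" "v \<le> y"
      have "0 \<le> \<sigma> * h v + M" using h[of v] \<sigma> v that y by auto
      then show "\<exists>D. (Z has_real_derivative D) (at v) \<and> 0 \<le> D"
        using Z[of v] v that
        by (intro exI[of _ "2 * (\<sigma> * h v + M) * (W v)\<^sup>2 * exp (\<sigma> * (2 * M * (v - p)))"]) auto
    qed
    have "(Z \<longlongrightarrow> \<sigma> * w\<^sup>2 * exp (\<sigma> * (2 * M * (p - p)))) (at_right p)"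
      unfolding Z_def by (intro tendsto_intros lim)
    moreover have "eventually (\<lambda>z. Z z \<le> Z y) (at_right p)"
      using y(1) unfolding eventually_at_right_field by (intro exI[of _ y]) (auto intro: Z_mono)
    ultimately have "\<sigma> * w\<^sup>2 * exp (\<sigma> * (2 * M * (p - p))) \<le> Z y"
      by (intro tendsto_upperbound) auto
    then show ?thesis by (simp add: Z_def)
  qed
  have exp2: "(exp (c * (y - p)))\<^sup>2 = exp (2 * c * (y - p))" for c y
    by (simp add: power2_eq_square flip: exp_add)
  have nz: "W y \<noteq> 0" if "p < y" "y \<le> x" for y
    using mono[OF that, of 1] w by auto
  have pos: "W x > 0"
  proof (rule ccontr)
    assume "\<not> W x > 0"
    with nz px have neg: "W x < 0" by force
    have "eventually (\<lambda>y. W y > 0) (at_right p)" by (rule order_tendstoD(1)[OF lim w])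
    moreover have "eventually (\<lambda>y. p < y \<and> y < x) (at_right p)"
      using px eventually_at_right_field by blast
    ultimately have "eventually (\<lambda>y. W y > 0 \<and> p < y \<and> y < x) (at_right p)"
      by eventually_elim auto
    then obtain y where y: "W y > 0" "p < y" "y < x"
      using eventually_happens'[OF trivial_limit_at_right_real] by blast
    have "\<exists>z. y \<le> z \<and> z \<le> x \<and> W z = 0"
      using y neg DERIV_isCont[OF d] by (intro IVT2) auto
    with nz y show False by force
  qed
  have "(w * exp (- M * (x - p)))\<^sup>2 \<le> (W x)\<^sup>2"
    using mult_right_mono[OF mono[OF px order_refl, of 1] exp_ge_zero[of "2 * - M * (x - p)"]]
    unfolding power_mult_distrib exp2 by (simp add: mult.assoc flip: exp_add)
  then show "w * exp (- M * (x - p)) \<le> W x" by (rule power2_le_imp_le) (use pos in simp)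
  have "(W x)\<^sup>2 \<le> (w * exp (M * (x - p)))\<^sup>2"
    using mult_right_mono[OF mono[OF px order_refl, of "-1"] exp_ge_zero[of "2 * M * (x - p)"]]
    unfolding power_mult_distrib exp2 by (simp add: mult.assoc flip: exp_add)
  then show "W x \<le> w * exp (M * (x - p))" by (rule power2_le_imp_le) (use w in simp)
qed

lemma bounded_decay_imp_powr_decay:
  fixes f x :: real
  assumes "\<bar>f\<bar> \<le> K" "\<bar>x * f\<bar> \<le> K" "x \<noteq> 0" "0 \<le> \<theta>" "\<theta> \<le> 1"
  shows "\<bar>f\<bar> \<le> K * \<bar>x\<bar> powr (-\<theta>)"
proof (cases "\<bar>x\<bar> \<le> 1")
  case True
  have "1 \<le> \<bar>x\<bar> powr (-\<theta>)"
    using powr_mono2'[of "-\<theta>" "\<bar>x\<bar>" 1] assms True by auto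
  then have "K * 1 \<le> K * \<bar>x\<bar> powr (-\<theta>)" using assms by (intro mult_left_mono) auto
  with assms show ?thesis by simp
next
  case False
  have "\<bar>x\<bar> powr (-1) \<le> \<bar>x\<bar> powr (-\<theta>)" using False assms by (intro powr_mono) auto
  moreover have "\<bar>f\<bar> \<le> K * \<bar>x\<bar> powr (-1)"
    using assms by (simp add: powr_minus field_simps abs_mult)
  moreover have "0 \<le> K" using assms by linarith
  ultimately show ?thesis using mult_left_mono by fastforce
qed

section \<open>From the Euler system to balance laws for the profiles\<close>

text \<open>The speed at \<open>r = 1\<close> as a function of time, which there equals x.\<close>

definition speed_profile :: "real \<Rightarrow> (real \<Rightarrow> real) \<Rightarrow> real \<Rightarrow> real \<Rightarrow> real" where
  "speed_profile lam f a x = - quot_at0 f a x / lam"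

lemma sim_speed_eq: "sim_speed lam f a (t, r) = r powr (1 - lam) * speed_profile lam f a (t / r powr lam)"
  by (simp add: sim_speed_def speed_profile_def)

lemma C1_on_slice:
  assumes f: "C1_on f {(t, r). r > 0 \<and> t / r powr lam \<in> X}" and X: "open X" "x \<in> X"
  shows "\<exists>D. ((\<lambda>s. f (s, 1)) has_real_derivative D) (at x)"
proof -
  let ?S = "{(t, r). r > 0 \<and> t / r powr lam \<in> X}"
  obtain ft fr where "has_C1_partials_on f ft fr ?S" using f unfolding C1_on_def by blast
  then have d: "(f has_derivative (\<lambda>(a, b). ft (x, 1) * a + fr (x, 1) * b)) (at (x, 1) within ?S)"
    using X unfolding has_C1_partials_on_def by auto
  have "((\<lambda>s. (s, 1 :: real)) has_derivative (\<lambda>h. (h, 0))) (at x within X)"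
    by (auto intro!: derivative_eq_intros)
  moreover have "(f has_derivative (\<lambda>(a, b). ft (x, 1) * a + fr (x, 1) * b)) (at (x, 1) within (\<lambda>s. (s, 1)) ` X)"
    by (rule has_derivative_subset[OF d]) auto
  ultimately have "((\<lambda>s. f (s, 1)) has_derivative (\<lambda>h. case (h, 0) of (a, b) \<Rightarrow> ft (x, 1) * a + fr (x, 1) * b))
      (at x within X)"
    by (rule has_derivative_in_compose)
  then have "((\<lambda>s. f (s, 1)) has_derivative (\<lambda>h. ft (x, 1) * h)) (at x within X)" by simp
  then show ?thesis
    unfolding at_within_open[OF X(2,1)] has_field_derivative_def by blast
qed

text \<open>At \<open>r = 1\<close> one has \<open>q\<^sub>t = Q'\<close> and \<open>f\<^sub>r = (a + 1 - \<lambda>) F - \<lambda> x F'\<close>, so the partial differential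
equation at the single radius 1 already contains the ordinary one.\<close>

lemma self_similar_balance_ODE:
  fixes Q F f q :: "real \<Rightarrow> real"
  assumes Q: "(Q has_real_derivative Q') (at x)" and F: "(F has_real_derivative F') (at x)"
    and q: "\<And>s. q s = Q s"
    and f: "\<And>y. y > 0 \<Longrightarrow> f y = y powr (a + 1 - lam) * F (x / y powr lam)"
    and PDE: "deriv q x + deriv f 1 = s"
  shows "((\<lambda>x. Q x - lam * x * F x) has_real_derivative s - (a + 1) * F x) (at x)"
proof -
  have "q = Q" using q by blast
  then have "deriv q x = Q'" using Q by (simp add: DERIV_imp_deriv)
  moreover have "deriv f 1 = (a + 1 - lam) * F x - lam * x * F'"
  proof (rule DERIV_imp_deriv, rule has_field_derivative_transform_within_open)
    have "((\<lambda>y. x / y powr lam) has_real_derivative - lam * x) (at 1)"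
      by (auto intro!: derivative_eq_intros simp: field_simps)
    moreover have "(F has_real_derivative F') (at (x / 1 powr lam))" using F by simp
    ultimately have "((\<lambda>y. F (x / y powr lam)) has_real_derivative F' * (- lam * x)) (at 1)"
      by (rule DERIV_chain2[rotated])
    moreover have "((\<lambda>y. y powr (a + 1 - lam)) has_real_derivative (a + 1 - lam)) (at (1 :: real))"
      by (auto intro!: derivative_eq_intros)
    ultimately have "((\<lambda>y. y powr (a + 1 - lam) * F (x / y powr lam)) has_real_derivative
      (a + 1 - lam) * F (x / 1 powr lam) + F' * (- lam * x) * 1 powr (a + 1 - lam)) (at 1)"
      by (rule DERIV_mult[rotated])
    then show "((\<lambda>y. y powr (a + 1 - lam) * F (x / y powr lam)) has_real_derivative
      (a + 1 - lam) * F x - lam * x * F') (at 1)" by (simp add: algebra_simps)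
    show "open {0 :: real<..}" by simp
  qed (use f in auto)
  ultimately have "Q' - (lam * F x + F' * (lam * x)) = s - (a + 1) * F x"
    using PDE by (simp add: algebra_simps)
  then show ?thesis by (auto intro!: derivative_eq_intros Q F)
qed

context similarity_shock_solution
begin

text \<open>Velocity and sound speed are \<open>r\<^bsup>1 - \<lambda>\<^esup>\<close> times U and A; pressure and energy density are \<open>r\<^bsup>2 - 2 \<lambda>\<^esup>\<close>
times P and E.\<close>

abbreviation U :: "real \<Rightarrow> real" where "U \<equiv> speed_profile lam V l"
abbreviation A :: "real \<Rightarrow> real" where "A \<equiv> speed_profile lam C L"

definition P :: "real \<Rightarrow> real" where "P x = ideal_pressure \<gamma> (R x) (energy_of_sound_speed \<gamma> (A x))"
definition E :: "real \<Rightarrow> real" where "E x = R x * (energy_of_sound_speed \<gamma> (A x) + (U x)\<^sup>2 / 2)"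

lemma smooth_region:
  assumes "x \<notin> {-1, B}"
  obtains X where "X \<in> {{..<-1}, {-1<..<B}, {B<..}}" "x \<in> X" "open X"
proof -
  consider "x < -1" | "-1 < x" "x < B" | "B < x" using assms by fastforce
  then show thesis
  proof cases
    case 1 then show ?thesis by (intro that[of "{..<-1}"]) auto
  next
    case 2 then show ?thesis by (intro that[of "{-1<..<B}"]) auto
  next
    case 3 then show ?thesis by (intro that[of "{B<..}"]) auto
  qed
qed

lemma profiles_differentiable:
  assumes "x \<notin> {-1, B}"
  obtains R' U' A' where "(R has_real_derivative R') (at x)" "(U has_real_derivative U') (at x)"
    "(A has_real_derivative A') (at x)"
proof -
  obtain X where X: "X \<in> {{..<-1}, {-1<..<B}, {B<..}}" "x \<in> X" "open X"
    using smooth_region[OF assms] .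
  from classical[OF X(1)] show thesis
    unfolding classical_radial_Euler_def Let_def
    using C1_on_slice[of "sim_rho lam R" lam X x] C1_on_slice[of "sim_speed lam V l" lam X x]
      C1_on_slice[of "sim_speed lam C L" lam X x] X(2,3) that
    by (auto simp: sim_rho_def sim_speed_eq)
qed

lemma profiles_isCont:
  assumes "x \<notin> {-1, B}"
  shows "isCont R x" "isCont U x" "isCont A x"
  using profiles_differentiable[OF assms] DERIV_isCont by blast+

lemma P_E_isCont:
  assumes "x \<notin> {-1, B}"
  shows "isCont P x" "isCont E x"
  unfolding P_def E_def ideal_pressure_def energy_of_sound_speed_def
  using gamma_gt_1 profiles_isCont[OF assms] by (auto intro!: continuous_intros)

lemma profile_ODEs:
  assumes x: "x \<notin> {-1, B}"
  defines "m \<equiv> real (n - 1)"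
  shows "((\<lambda>x. R x - lam * x * (R x * U x)) has_real_derivative 0 - (m + 1) * (R x * U x)) (at x)"
    and "((\<lambda>x. R x * U x - lam * x * (R x * (U x)\<^sup>2 + P x)) has_real_derivative
      m * P x - (m + 1 - lam + 1) * (R x * (U x)\<^sup>2 + P x)) (at x)"
    and "((\<lambda>x. E x - lam * x * ((E x + P x) * U x)) has_real_derivative
      0 - (m + 2 - 2 * lam + 1) * ((E x + P x) * U x)) (at x)"
proof -
  obtain X where X: "X \<in> {{..<-1}, {-1<..<B}, {B<..}}" "x \<in> X" "open X"
    using smooth_region[OF x] .
  obtain R' U' A' where d: "(R has_real_derivative R') (at x)" "(U has_real_derivative U') (at x)"
    "(A has_real_derivative A') (at x)"
    using profiles_differentiable[OF x] .
  have "\<exists>D. (P has_real_derivative D) (at x)" "\<exists>D. (E has_real_derivative D) (at x)"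
    unfolding P_def[abs_def] E_def[abs_def] ideal_pressure_def energy_of_sound_speed_def
    using gamma_gt_1 by (intro exI; auto intro!: derivative_eq_intros d)+
  then obtain P' E' where d': "(P has_real_derivative P') (at x)" "(E has_real_derivative E') (at x)"
    by blast
  have "(x, 1) \<in> {(t, r). r > 0 \<and> t / r powr lam \<in> X}" using X(2) by simp
  note pde = bspec[OF conjunct2[OF conjunct2[OF conjunct2[OF
    classical[OF X(1), unfolded classical_radial_Euler_def Let_def]]]] this, unfolded prod.case]
  have PDE: "deriv (\<lambda>s. 1 ^ (n - 1) * sim_rho lam R (s, 1)) x
      + deriv (\<lambda>y. y ^ (n - 1) * sim_rho lam R (x, y) * sim_speed lam V l (x, y)) 1 = 0"
    "deriv (\<lambda>s. 1 ^ (n - 1) * sim_rho lam R (s, 1) * sim_speed lam V l (s, 1)) x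
      + deriv (\<lambda>y. y ^ (n - 1) * (sim_rho lam R (x, y) * (sim_speed lam V l (x, y))\<^sup>2
        + ideal_pressure \<gamma> (sim_rho lam R (x, y)) (energy_of_sound_speed \<gamma> (sim_speed lam C L (x, y))))) 1
      = m * 1 ^ (n - 1 - 1) * ideal_pressure \<gamma> (sim_rho lam R (x, 1))
          (energy_of_sound_speed \<gamma> (sim_speed lam C L (x, 1)))"
    "deriv (\<lambda>s. 1 ^ (n - 1) * (sim_rho lam R (s, 1)
        * (energy_of_sound_speed \<gamma> (sim_speed lam C L (s, 1)) + (sim_speed lam V l (s, 1))\<^sup>2 / 2))) x
      + deriv (\<lambda>y. y ^ (n - 1) * sim_rho lam R (x, y) * sim_speed lam V l (x, y)
        * (energy_of_sound_speed \<gamma> (sim_speed lam C L (x, y)) + (sim_speed lam V l (x, y))\<^sup>2 / 2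
          + ideal_pressure \<gamma> (sim_rho lam R (x, y)) (energy_of_sound_speed \<gamma> (sim_speed lam C L (x, y)))
            / sim_rho lam R (x, y))) 1 = 0"
    unfolding m_def by (auto simp only: pde)
  have pw: "y ^ (n - 1) = y powr m" if "y > 0" for y :: real
    unfolding m_def using that by (simp add: powr_realpow)
  have sq: "(y powr (1 - lam))\<^sup>2 = y powr (2 - 2 * lam)" for y
    by (simp add: power2_eq_square flip: powr_add)
  have energy: "energy_of_sound_speed \<gamma> (y powr (1 - lam) * k) = y powr (2 - 2 * lam) * energy_of_sound_speed \<gamma> k" for y k
    by (simp add: energy_of_sound_speed_def power_mult_distrib sq)
  show "((\<lambda>x. R x - lam * x * (R x * U x)) has_real_derivative 0 - (m + 1) * (R x * U x)) (at x)"
  proof (rule self_similar_balance_ODE[OF d(1) DERIV_mult[OF d(1,2)] _ _ PDE(1)])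
    fix y :: real assume "y > 0"
    have "y powr m * y powr (1 - lam) = y powr (m + 1 - lam)"
      by (simp add: algebra_simps flip: powr_add)
    then show "y ^ (n - 1) * sim_rho lam R (x, y) * sim_speed lam V l (x, y)
      = y powr (m + 1 - lam) * (R (x / y powr lam) * U (x / y powr lam))"
      using pw[OF \<open>y > 0\<close>] by (simp add: sim_rho_def sim_speed_eq mult_ac)
  qed (simp add: sim_rho_def)
  have "((\<lambda>x. R x * (U x)\<^sup>2 + P x) has_real_derivative R' * (U x)\<^sup>2 + 2 * R x * U x * U' + P') (at x)"
    by (auto intro!: derivative_eq_intros d d' simp: algebra_simps)
  note F2 = this
  show "((\<lambda>x. R x * U x - lam * x * (R x * (U x)\<^sup>2 + P x)) has_real_derivative
      m * P x - (m + 1 - lam + 1) * (R x * (U x)\<^sup>2 + P x)) (at x)"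
  proof (rule self_similar_balance_ODE[OF DERIV_mult[OF d(1,2)] F2 _ _ trans[OF PDE(2)]])
    fix y :: real assume y: "y > 0"
    have p: "y powr m * y powr (2 - 2 * lam) = y powr (m + 1 - lam + 1 - lam)"
      by (simp add: algebra_simps flip: powr_add)
    show "y ^ (n - 1) * (sim_rho lam R (x, y) * (sim_speed lam V l (x, y))\<^sup>2
        + ideal_pressure \<gamma> (sim_rho lam R (x, y)) (energy_of_sound_speed \<gamma> (sim_speed lam C L (x, y))))
      = y powr (m + 1 - lam + 1 - lam) * (R (x / y powr lam) * (U (x / y powr lam))\<^sup>2 + P (x / y powr lam))"
      unfolding p[symmetric] pw[OF y] sim_speed_eq sim_rho_def P_def ideal_pressure_def
        energy power_mult_distrib sq by (simp add: algebra_simps)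
  qed (simp_all add: sim_rho_def sim_speed_eq P_def)
  have "((\<lambda>x. (E x + P x) * U x) has_real_derivative (E' + P') * U x + (E x + P x) * U') (at x)"
    by (auto intro!: derivative_eq_intros d d' simp: algebra_simps)
  note F3 = this
  show "((\<lambda>x. E x - lam * x * ((E x + P x) * U x)) has_real_derivative
      0 - (m + 2 - 2 * lam + 1) * ((E x + P x) * U x)) (at x)"
  proof (rule self_similar_balance_ODE[OF d'(2) F3 _ _ PDE(3)])
    fix y :: real assume y: "y > 0"
    have p: "y powr m * y powr (1 - lam) * y powr (2 - 2 * lam) = y powr (m + 2 - 2 * lam + 1 - lam)"
      by (simp add: algebra_simps flip: powr_add)
    show "y ^ (n - 1) * sim_rho lam R (x, y) * sim_speed lam V l (x, y)
        * (energy_of_sound_speed \<gamma> (sim_speed lam C L (x, y)) + (sim_speed lam V l (x, y))\<^sup>2 / 2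
          + ideal_pressure \<gamma> (sim_rho lam R (x, y)) (energy_of_sound_speed \<gamma> (sim_speed lam C L (x, y)))
            / sim_rho lam R (x, y))
      = y powr (m + 2 - 2 * lam + 1 - lam) * ((E (x / y powr lam) + P (x / y powr lam)) * U (x / y powr lam))"
      unfolding p[symmetric] pw[OF y] sim_speed_eq sim_rho_def P_def E_def ideal_pressure_def
        energy power_mult_distrib sq
      by (cases "R (x / y powr lam) = 0") (simp_all add: field_simps)
  qed (simp add: sim_rho_def sim_speed_eq E_def)
qed

text \<open>The shock moves with speed \<open>1 / (\<lambda> k)\<close> through \<open>r = 1\<close>, and multiplying the Rankine-Hugoniot
conditions by \<open>\<lambda> k\<close> gives the equality of the two one-sided limits.\<close>

lemma jump_limits:
  assumes k: "k \<in> {-1, B}"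
  shows "\<exists>v. ((\<lambda>x. R x - lam * x * (R x * U x)) \<longlongrightarrow> v) (at k)"
    and "\<exists>v. ((\<lambda>x. R x * U x - lam * x * (R x * (U x)\<^sup>2 + P x)) \<longlongrightarrow> v) (at k)"
    and "\<exists>v. ((\<lambda>x. E x - lam * x * ((E x + P x) * U x)) \<longlongrightarrow> v) (at k)"
proof -
  have k0: "k \<noteq> 0" using k B_pos by auto
  define F where "F X = at (k, 1) within {(t', r'). r' > 0 \<and> t' / r' powr lam \<in> X}" for X
  have slice: "((\<lambda>s. f (s, 1)) \<longlongrightarrow> v) (at k within X)" if "(f \<longlongrightarrow> v) (F X)" "k \<notin> X" for f :: "real \<times> real \<Rightarrow> real" and v X
  proof (rule filterlim_compose[OF that(1)])
    show "filterlim (\<lambda>s. (s, 1)) (F X) (at k within X)"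
      unfolding F_def filterlim_at
      using that(2) by (auto simp: eventually_at_filter intro!: tendsto_intros)
  qed
  obtain R1 U1 A1 R2 U2 A2 where
    lim: "(sim_rho lam R \<longlongrightarrow> R1) (F {..<k})" "(sim_speed lam V l \<longlongrightarrow> U1) (F {..<k})"
      "(sim_speed lam C L \<longlongrightarrow> A1) (F {..<k})" "(sim_rho lam R \<longlongrightarrow> R2) (F {k<..})"
      "(sim_speed lam V l \<longlongrightarrow> U2) (F {k<..})" "(sim_speed lam C L \<longlongrightarrow> A2) (F {k<..})"
    and jump: "1 / (lam * k) * (R2 - R1) = R2 * U2 - R1 * U1"
      "1 / (lam * k) * (R2 * U2 - R1 * U1)
        = (R2 * U2\<^sup>2 + ideal_pressure \<gamma> R2 (energy_of_sound_speed \<gamma> A2))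
          - (R1 * U1\<^sup>2 + ideal_pressure \<gamma> R1 (energy_of_sound_speed \<gamma> A1))"
      "1 / (lam * k) * (R2 * (energy_of_sound_speed \<gamma> A2 + U2\<^sup>2 / 2) - R1 * (energy_of_sound_speed \<gamma> A1 + U1\<^sup>2 / 2))
        = (R2 * (energy_of_sound_speed \<gamma> A2 + U2\<^sup>2 / 2) + ideal_pressure \<gamma> R2 (energy_of_sound_speed \<gamma> A2)) * U2
          - (R1 * (energy_of_sound_speed \<gamma> A1 + U1\<^sup>2 / 2) + ideal_pressure \<gamma> R1 (energy_of_sound_speed \<gamma> A1)) * U1"
    using Rankine_Hugoniot[OF k, unfolded Rankine_Hugoniot_across_def Let_def, rule_format, of 1 k]
    unfolding F_def by auto
  have left: "(R \<longlongrightarrow> R1) (at_left k)" "(U \<longlongrightarrow> U1) (at_left k)" "(A \<longlongrightarrow> A1) (at_left k)"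
    and right: "(R \<longlongrightarrow> R2) (at_right k)" "(U \<longlongrightarrow> U2) (at_right k)" "(A \<longlongrightarrow> A2) (at_right k)"
    using lim[THEN slice] by (auto simp: sim_rho_def sim_speed_eq)
  have g0: "\<gamma> * (\<gamma> - 1) \<noteq> 0" using gamma_gt_1 by simp
  have flux: "x2 - lam * k * y2 = x1 - lam * k * y1" if "1 / (lam * k) * (x2 - x1) = y2 - y1" for x1 x2 y1 y2
    using that lam_gt_1 k0 by (simp add: field_simps)
  have both: "\<exists>v. (f \<longlongrightarrow> v) (at k)" if "(f \<longlongrightarrow> v1) (at_left k)" "(f \<longlongrightarrow> v2) (at_right k)" "v2 = v1"
    for f :: "real \<Rightarrow> real" and v1 v2
    using that filterlim_at_split by blast
  show "\<exists>v. ((\<lambda>x. R x - lam * x * (R x * U x)) \<longlongrightarrow> v) (at k)"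
    by (rule both[OF _ _ flux[OF jump(1)]]; intro tendsto_intros left right)
  show "\<exists>v. ((\<lambda>x. R x * U x - lam * x * (R x * (U x)\<^sup>2 + P x)) \<longlongrightarrow> v) (at k)"
    unfolding P_def
    by (rule both[OF _ _ flux[OF jump(2)]]; unfold ideal_pressure_def energy_of_sound_speed_def;
        intro tendsto_intros left right g0)
  show "\<exists>v. ((\<lambda>x. E x - lam * x * ((E x + P x) * U x)) \<longlongrightarrow> v) (at k)"
    unfolding P_def E_def
    by (rule both[OF _ _ flux[OF jump(3)]]; unfold ideal_pressure_def energy_of_sound_speed_def;
        intro tendsto_intros left right g0; simp)
qed

end

section \<open>Bounds on the profiles\<close>

locale bounded_shock_solution = similarity_shock_solution +
  assumes V_bounds: "\<exists>a b. 0 < a \<and> (\<forall>x. a \<le> 1 + V x \<and> 1 + V x \<le> b)"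
    and V_limit: "(V \<longlongrightarrow> - 2 * (lam - 1) / (real n * \<gamma>)) at_top"
    and lam_lt: "lam < 1 + real n / 2"
begin

definition q :: real where "q = 2 * (lam - 1) / real n"

lemma n_pos: "real n > 0" and q_pos: "q > 0" and q_lt: "q < 1"
  using n_cases lam_gt_1 lam_lt by (auto simp: q_def field_simps)

lemma velocity_bounds:
  "\<exists>K. \<forall>x. \<bar>quot_at0 V l x\<bar> \<le> K \<and> \<bar>x * quot_at0 V l x\<bar> \<le> K"
proof -
  obtain a b where ab: "0 < a" "\<And>x. a \<le> 1 + V x" "\<And>x. 1 + V x \<le> b"
    using V_bounds by blast
  have V: "\<bar>V x\<bar> \<le> 1 + b" for x using ab(1) ab(2,3)[of x] by linarith
  have "eventually (\<lambda>x. dist (V x / x) l < 1) (at 0)"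
    using at_zero(3) by (rule tendstoD) simp
  then obtain d where d: "d > 0" "\<And>x. x \<noteq> 0 \<Longrightarrow> \<bar>x\<bar> < d \<Longrightarrow> \<bar>V x / x - l\<bar> < 1"
    unfolding eventually_at by (auto simp: dist_real_def)
  define K where "K = max (1 + \<bar>l\<bar>) (max ((1 + b) / d) (1 + b))"
  show ?thesis
  proof (intro exI[of _ K] allI conjI)
    fix x
    consider "x = 0" | "x \<noteq> 0" "\<bar>x\<bar> < d" | "x \<noteq> 0" "d \<le> \<bar>x\<bar>" by linarith
    then show "\<bar>quot_at0 V l x\<bar> \<le> K"
    proof cases
      case 2
      then show ?thesis using d(2)[of x] by (auto simp: quot_at0_def K_def)
    next
      case 3
      then have "\<bar>V x\<bar> / \<bar>x\<bar> \<le> (1 + b) / d"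
        using V[of x] d by (intro frac_le) auto
      with 3 show ?thesis by (simp add: quot_at0_def K_def)
    qed (simp add: quot_at0_def K_def)
    show "\<bar>x * quot_at0 V l x\<bar> \<le> K"
      using V[of x] by (auto simp: quot_at0_def K_def)
  qed
qed

text \<open>The quantity \<open>W = R (1 + V)\<close> satisfies \<open>W' = h W\<close> with bounded h, and it equals 1 behind the
incoming shock and is continuous across the reflected one. So it stays positive and bounded on
bounded sets of x. Beyond these V is negative, because its limit is, hence h is negative and W
decreases.\<close>

lemma density_bounds:
  "\<exists>K. \<forall>x. 0 < R x \<and> R x \<le> K"
proof -
  obtain a b where ab: "0 < a" "\<And>x. a \<le> 1 + V x" "\<And>x. 1 + V x \<le> b"
    using V_bounds by blast
  obtain K0 where K0: "\<And>x. \<bar>quot_at0 V l x\<bar> \<le> K0"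
    using velocity_bounds by blast
  define W where "W x = R x * (1 + V x)" for x
  define h where "h x = real n / lam * quot_at0 V l x / (1 + V x)" for x
  define M where "M = real n / lam * K0 / a"
  have V1: "1 + V x > 0" for x using ab(1) ab(2)[of x] by linarith
  have W: "(W has_real_derivative h x * W x) (at x)" if "x \<in> {-1<..<B} \<union> {B<..}" for x
    using density_ODE[OF that] V1[of x] unfolding W_def h_def by (simp add: mult_ac)
  have h: "\<bar>h x\<bar> \<le> M" for x
  proof -
    have "\<bar>h x\<bar> = real n / lam * \<bar>quot_at0 V l x\<bar> / (1 + V x)"
      using V1[of x] lam_gt_1 by (simp add: h_def abs_mult)
    also have "\<dots> \<le> M"
      unfolding M_def using K0[of x] ab(1,2) lam_gt_1 by (intro frac_le mult_left_mono) auto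
    finally show ?thesis .
  qed
  have M: "M \<ge> 0" using h[of 0] by linarith
  have "(W \<longlongrightarrow> R (-1) * (1 + V (-1))) (at_right (-1))"
    unfolding W_def by (intro tendsto_intros incoming_limits)
  moreover have "R (-1) * (1 + V (-1)) = 1"
  proof -
    have "1 + - 2 / (\<gamma> + 1) = (\<gamma> - 1) / (\<gamma> + 1)" using gamma_gt_1 by (simp add: field_simps)
    then show ?thesis unfolding incoming_state(1,3) using gamma_gt_1 by simp
  qed
  ultimately have start: "(W \<longlongrightarrow> 1) (at_right (-1))" by simp
  have W1: "exp (- M * (x + 1)) \<le> W x" "W x \<le> exp (M * (x + 1))" if "-1 < x" "x < B" for x
    using linear_ODE_bounds[OF that(1), where W = W and h = h and M = M and w = 1] W h start that by auto
  obtain V1 R1 V2 R2 where lim: "(V \<longlongrightarrow> V1) (at_left B)" "(R \<longlongrightarrow> R1) (at_left B)"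
      "(V \<longlongrightarrow> V2) (at_right B)" "(R \<longlongrightarrow> R2) (at_right B)"
    and jump: "R2 * (1 + V2) = R1 * (1 + V1)" and RB: "R B \<in> {R1, R2}"
    using reflected_shock by blast
  define w where "w = R1 * (1 + V1)"
  have "(W \<longlongrightarrow> w) (at_left B)"
    unfolding W_def w_def by (intro tendsto_intros lim)
  moreover have "eventually (\<lambda>x. exp (- M * (B + 1)) \<le> W x) (at_left B)"
    unfolding eventually_at_left_field
  proof (intro exI[of _ "-1"] conjI allI impI)
    fix x assume x: "-1 < x" "x < B"
    have "- M * (B + 1) \<le> - M * (x + 1)" using x M by (simp add: mult_left_mono)
    then show "exp (- M * (B + 1)) \<le> W x" using W1(1)[OF x] by (meson exp_le_cancel_iff order_trans)
  qed (use B_pos in simp)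
  ultimately have "exp (- M * (B + 1)) \<le> w" by (rule tendsto_lowerbound) simp
  then have w: "w > 0" using exp_gt_zero less_le_trans by blast
  have "a \<le> 1 + V1" "a \<le> 1 + V2"
    using ab(2) by (auto intro!: tendsto_lowerbound[OF tendsto_add[OF tendsto_const lim(1)]]
      tendsto_lowerbound[OF tendsto_add[OF tendsto_const lim(3)]])
  then have R12: "R1 > 0" "R2 > 0"
    using w jump ab(1) zero_less_mult_iff[of R1 "1 + V1"] zero_less_mult_iff[of R2 "1 + V2"]
    unfolding w_def by auto
  have "(W \<longlongrightarrow> w) (at_right B)"
    unfolding W_def w_def jump[symmetric] by (intro tendsto_intros lim)
  then have W2: "w * exp (- M * (x - B)) \<le> W x" "W x \<le> w * exp (M * (x - B))" if "B < x" for x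
    using linear_ODE_bounds[OF that, where W = W and h = h and M = M and w = w] W h w that by auto
  have pos: "0 < R x" for x
  proof -
    have *: "W x > 0 \<Longrightarrow> R x > 0" using V1[of x] by (simp add: W_def zero_less_mult_iff)
    consider "x < -1" | "x = -1" | "-1 < x" "x < B" | "x = B" | "B < x" by linarith
    then show ?thesis
    proof cases
      case 3
      show ?thesis using * W1(1)[OF 3] by (meson exp_gt_zero less_le_trans)
    next
      case 5
      have "0 < w * exp (- M * (x - B))" using w by simp
      with * W2(1)[OF 5] show ?thesis by linarith
    qed (use quiescent incoming_state gamma_gt_1 R12 RB in auto)
  qed
  have "- 2 * (lam - 1) / (real n * \<gamma>) < 0"
    using lam_gt_1 gamma_gt_1 n_pos by (simp add: divide_neg_pos)
  from order_tendstoD(2)[OF V_limit this] obtain x1 where x1: "\<And>x. x1 \<le> x \<Longrightarrow> V x < 0"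
    unfolding eventually_at_top_linorder by blast
  define y1 where "y1 = max x1 (B + 1)"
  have W_right: "W x \<le> w * exp (M * (y1 - B))" if "B < x" for x
  proof -
    have "W x \<le> w * exp (M * (min x y1 - B))"
    proof (cases "x \<le> y1")
      case True
      with W2(2)[OF that] show ?thesis by simp
    next
      case False
      then have "W x \<le> W y1"
      proof (intro DERIV_nonpos_imp_nonincreasing[of y1 x W])
        fix y assume "y1 \<le> y" "y \<le> x"
        then have y: "B < y" "V y < 0" "y > 0" using x1[of y] B_pos unfolding y1_def by auto
        have "h y \<le> 0" using y V1[of y] lam_gt_1 unfolding h_def quot_at0_def
          by (auto intro!: divide_nonpos_pos mult_nonneg_nonpos simp: divide_neg_pos less_imp_le)
        moreover have "W y > 0" using pos V1[of y] by (simp add: W_def)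
        ultimately have "h y * W y \<le> 0" by (simp add: mult_nonpos_nonneg)
        with W[of y] y show "\<exists>D. (W has_real_derivative D) (at y) \<and> D \<le> 0" by auto
      qed simp
      also have "W y1 \<le> w * exp (M * (y1 - B))" by (rule W2(2)) (simp add: y1_def)
      finally show ?thesis using False by (simp add: min_def)
    qed
    also have "\<dots> \<le> w * exp (M * (y1 - B))"
      using w M by (auto intro!: mult_left_mono)
    finally show ?thesis .
  qed
  have R_le: "R x \<le> c / a" if "W x \<le> c" for x c
  proof -
    have "R x * a \<le> R x * (1 + V x)" using pos[of x] ab(2)[of x] by (intro mult_left_mono) auto
    then have "R x * a \<le> c" using that unfolding W_def by linarith
    then show ?thesis using ab(1) by (simp add: pos_le_divide_eq)
  qed
  define K where "K = Max {1, R (-1), R B, exp (M * (B + 1)) / a, w * exp (M * (y1 - B)) / a}"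
  have K: "1 \<le> K" "R (-1) \<le> K" "R B \<le> K" "exp (M * (B + 1)) / a \<le> K" "w * exp (M * (y1 - B)) / a \<le> K"
    unfolding K_def by (auto intro!: Max_ge)
  have "R x \<le> K" for x
  proof -
    consider "x < -1" | "x = -1" | "-1 < x" "x < B" | "x = B" | "B < x" by linarith
    then show ?thesis
    proof cases
      case 3
      have "exp (M * (x + 1)) \<le> exp (M * (B + 1))" using 3 M by (simp add: mult_left_mono)
      with W1(2)[OF 3] have "W x \<le> exp (M * (B + 1))" by linarith
      from R_le[OF this] K(4) show ?thesis by linarith
    next
      case 5
      from R_le[OF W_right[OF 5]] K(5) show ?thesis by linarith
    qed (use K quiescent in auto)
  qed
  with pos show ?thesis by blast
qed

text \<open>The exact integral gives \<open>R (C / x)\<^sup>2\<close> as a constant times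
\<open>R\<^bsup>\<gamma> - q\<^esup> (1 + V)\<^bsup>-q\<^esup>\<close>. Since \<open>q < 1 < \<gamma>\<close>, the upper bound for R and the lower bound for
\<open>1 + V\<close> suffice, however fast the sound speed itself grows.\<close>

lemma sound_speed_bound:
  "\<exists>K. \<forall>x. R x * (quot_at0 C L x)\<^sup>2 \<le> K"
proof -
  obtain a b where ab: "0 < a" "\<And>x. a \<le> 1 + V x" "\<And>x. 1 + V x \<le> b"
    using V_bounds by blast
  obtain K where R: "\<And>x. 0 < R x" "\<And>x. R x \<le> K" using density_bounds by blast
  have *: "\<exists>K'. \<forall>x\<in>S. R x * (quot_at0 C L x)\<^sup>2 \<le> K'" if S: "S \<in> {{-1<..<B}, {B<..}}" for S
  proof -
    obtain k where k: "\<And>x. x \<in> S \<Longrightarrow> R x powr (q + 1 - \<gamma>) * (quot_at0 C L x)\<^sup>2 * \<bar>1 + V x\<bar> powr q = k"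
      using exact_integral[OF S] unfolding Let_def q_def by blast
    have "R x * (quot_at0 C L x)\<^sup>2 \<le> \<bar>k\<bar> * K powr (\<gamma> - q) * a powr (-q)" if "x \<in> S" for x
    proof -
      have V: "1 + V x > 0" using ab(1) ab(2)[of x] by linarith
      have "R x * (quot_at0 C L x)\<^sup>2
        = (R x powr (q + 1 - \<gamma>) * R x powr (\<gamma> - q)) * (quot_at0 C L x)\<^sup>2
          * (\<bar>1 + V x\<bar> powr q * (1 + V x) powr (-q))"
        using R(1)[of x] V by (simp flip: powr_add)
      also have "\<dots> = k * R x powr (\<gamma> - q) * (1 + V x) powr (-q)"
        unfolding k[OF that, symmetric] by (simp add: mult_ac)
      also have "\<dots> \<le> \<bar>k\<bar> * R x powr (\<gamma> - q) * (1 + V x) powr (-q)"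
        by (intro mult_right_mono) auto
      also have "\<dots> \<le> \<bar>k\<bar> * K powr (\<gamma> - q) * a powr (-q)"
      proof -
        have "R x powr (\<gamma> - q) \<le> K powr (\<gamma> - q)"
          using R(1)[of x] R(2)[of x] q_lt gamma_gt_1 by (intro powr_mono2) auto
        moreover have "(1 + V x) powr (-q) \<le> a powr (-q)"
          using ab(1,2) q_pos by (intro powr_mono2') auto
        ultimately show ?thesis by (intro mult_mono) auto
      qed
      finally show ?thesis .
    qed
    then show ?thesis by blast
  qed
  obtain K1 where K1: "\<And>x. -1 < x \<Longrightarrow> x < B \<Longrightarrow> R x * (quot_at0 C L x)\<^sup>2 \<le> K1"
    using *[of "{-1<..<B}"] by force
  obtain K2 where K2: "\<And>x. B < x \<Longrightarrow> R x * (quot_at0 C L x)\<^sup>2 \<le> K2"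
    using *[of "{B<..}"] by force
  define K' where "K' = Max {0, R (-1) * (quot_at0 C L (-1))\<^sup>2, K1, R B * (quot_at0 C L B)\<^sup>2, K2}"
  have K': "0 \<le> K'" "R (-1) * (quot_at0 C L (-1))\<^sup>2 \<le> K'" "K1 \<le> K'" "R B * (quot_at0 C L B)\<^sup>2 \<le> K'" "K2 \<le> K'"
    unfolding K'_def by (auto intro!: Max_ge)
  have "R x * (quot_at0 C L x)\<^sup>2 \<le> K'" for x
  proof -
    consider "x < -1" | "x = -1" | "-1 < x" "x < B" | "x = B" | "B < x" by linarith
    then show ?thesis
    proof cases
      case 1
      with K' quiescent show ?thesis by (simp add: quot_at0_def)
    next
      case 3
      with K1[of x] K' show ?thesis by linarith
    next
      case 5
      with K2[of x] K' show ?thesis by linarith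
    qed (use K' in auto)
  qed
  then show ?thesis by blast
qed

lemma profile_bounds:
  "\<exists>K. \<forall>x. 0 < R x \<and> \<bar>R x\<bar> \<le> K \<and> \<bar>U x\<bar> \<le> K \<and> \<bar>x * U x\<bar> \<le> K \<and> \<bar>P x\<bar> \<le> K \<and> \<bar>E x\<bar> \<le> K"
proof -
  obtain K1 where U: "\<And>x. \<bar>quot_at0 V l x\<bar> \<le> K1" "\<And>x. \<bar>x * quot_at0 V l x\<bar> \<le> K1"
    using velocity_bounds by blast
  obtain K2 where R: "\<And>x. 0 < R x" "\<And>x. R x \<le> K2" using density_bounds by blast
  obtain K3 where A: "\<And>x. R x * (quot_at0 C L x)\<^sup>2 \<le> K3" using sound_speed_bound by blast
  have g: "\<gamma> * (\<gamma> - 1) > 0" using gamma_gt_1 by simp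
  have U': "\<bar>U x\<bar> \<le> K1 / lam" "\<bar>x * U x\<bar> \<le> K1 / lam" for x
    using U[of x] lam_gt_1 by (auto simp: speed_profile_def abs_mult divide_right_mono)
  have A': "0 \<le> R x * (A x)\<^sup>2 \<and> R x * (A x)\<^sup>2 \<le> K3 / lam\<^sup>2" for x
    using A[of x] R(1)[of x] lam_gt_1 by (simp add: speed_profile_def power_divide divide_right_mono)
  have RU: "0 \<le> R x * (U x)\<^sup>2 \<and> R x * (U x)\<^sup>2 \<le> K2 * (K1 / lam)\<^sup>2" for x
  proof -
    have "(U x)\<^sup>2 \<le> (K1 / lam)\<^sup>2" using U'(1)[of x] by (metis abs_ge_zero power2_abs power_mono)
    then show ?thesis using R[of x] by (intro conjI mult_mono) auto
  qed
  have P: "P x = R x * (A x)\<^sup>2 / \<gamma>" and E: "E x = R x * (A x)\<^sup>2 / (\<gamma> * (\<gamma> - 1)) + R x * (U x)\<^sup>2 / 2" for x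
    using gamma_gt_1 unfolding P_def E_def ideal_pressure_def energy_of_sound_speed_def
    by (simp_all add: field_simps)
  have P': "\<bar>P x\<bar> \<le> K3 / lam\<^sup>2 / \<gamma>" for x
  proof -
    have "0 \<le> R x * (A x)\<^sup>2 / \<gamma>" "R x * (A x)\<^sup>2 / \<gamma> \<le> K3 / lam\<^sup>2 / \<gamma>"
      using divide_right_mono[OF conjunct2[OF A'[of x]], of \<gamma>] A'[of x] gamma_gt_1 by auto
    then show ?thesis unfolding P by linarith
  qed
  have E': "\<bar>E x\<bar> \<le> K3 / lam\<^sup>2 / (\<gamma> * (\<gamma> - 1)) + K2 * (K1 / lam)\<^sup>2 / 2" for x
  proof -
    have "0 \<le> R x * (A x)\<^sup>2 / (\<gamma> * (\<gamma> - 1))" "R x * (A x)\<^sup>2 / (\<gamma> * (\<gamma> - 1)) \<le> K3 / lam\<^sup>2 / (\<gamma> * (\<gamma> - 1))"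
      using divide_right_mono[OF conjunct2[OF A'[of x]], of "\<gamma> * (\<gamma> - 1)"] A'[of x] g by auto
    with RU[of x] show ?thesis unfolding E by auto
  qed
  define K where "K = Max {K2, K1 / lam, K3 / lam\<^sup>2 / \<gamma>, K3 / lam\<^sup>2 / (\<gamma> * (\<gamma> - 1)) + K2 * (K1 / lam)\<^sup>2 / 2}"
  have "K2 \<le> K" "K1 / lam \<le> K" "K3 / lam\<^sup>2 / \<gamma> \<le> K"
    "K3 / lam\<^sup>2 / (\<gamma> * (\<gamma> - 1)) + K2 * (K1 / lam)\<^sup>2 / 2 \<le> K"
    unfolding K_def by (auto intro!: Max_ge)
  then have "0 < R x \<and> \<bar>R x\<bar> \<le> K \<and> \<bar>U x\<bar> \<le> K \<and> \<bar>x * U x\<bar> \<le> K \<and> \<bar>P x\<bar> \<le> K \<and> \<bar>E x\<bar> \<le> K" for x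
    using R[of x] U'[of x] P'[of x] E'[of x] by (intro conjI; linarith)
  then show ?thesis by blast
qed

lemma R_pos: "0 < R x"
  using profile_bounds by blast

lemma profiles_measurable [measurable]:
  "R \<in> borel_measurable borel" "U \<in> borel_measurable borel" "A \<in> borel_measurable borel"
  "P \<in> borel_measurable borel" "E \<in> borel_measurable borel"
  by (rule borel_measurable_isCont_off_finite[of "{-1, B}"]; use profiles_isCont P_E_isCont in simp)+

lemma flux_bounds:
  obtains K where "\<And>x. \<bar>R x\<bar> \<le> K" "\<And>x. \<bar>R x * U x\<bar> \<le> K" "\<And>x. \<bar>P x\<bar> \<le> K"
    "\<And>x. \<bar>R x * (U x)\<^sup>2\<bar> \<le> K" "\<And>x. \<bar>R x * (U x)\<^sup>2 + P x\<bar> \<le> K"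
    "\<And>x. \<bar>real (n - 1) * P x\<bar> \<le> K"
    "\<And>x. \<bar>E x\<bar> \<le> K" "\<And>x. \<bar>(E x + P x) * U x\<bar> \<le> K"
    "\<And>x. \<bar>x * (R x * U x)\<bar> \<le> K" "\<And>x. \<bar>x * ((E x + P x) * U x)\<bar> \<le> K"
proof -
  obtain K where K: "\<And>x. \<bar>R x\<bar> \<le> K" "\<And>x. \<bar>U x\<bar> \<le> K" "\<And>x. \<bar>x * U x\<bar> \<le> K" "\<And>x. \<bar>P x\<bar> \<le> K" "\<And>x. \<bar>E x\<bar> \<le> K"
    using profile_bounds by blast
  have K0: "0 \<le> K" using K(1)[of 0] by linarith
  define K' where "K' = K + 2 * K + 2 * (K * K) + K * K\<^sup>2"
  have K': "K \<le> K'" "2 * K \<le> K'" "K * K \<le> K'" "2 * K * K \<le> K'" "K * K\<^sup>2 \<le> K'" "K * K\<^sup>2 + K \<le> K'"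
    using K0 unfolding K'_def by auto
  have EP: "\<bar>E x + P x\<bar> \<le> 2 * K" for x using K(4,5)[of x] by linarith
  have RUU: "\<bar>R x * (U x)\<^sup>2\<bar> \<le> K * K\<^sup>2" for x
    unfolding abs_mult power_abs using K(1,2)[of x] K0 by (intro mult_mono power_mono) auto
  show thesis
  proof (rule that[of K'])
    fix x
    show "\<bar>R x\<bar> \<le> K'" "\<bar>P x\<bar> \<le> K'" "\<bar>E x\<bar> \<le> K'" using K[of x] K' by linarith+
    have "\<bar>R x * U x\<bar> \<le> K * K" unfolding abs_mult using K[of x] K0 by (intro mult_mono) auto
    then show "\<bar>R x * U x\<bar> \<le> K'" using K' by linarith
    show "\<bar>R x * (U x)\<^sup>2\<bar> \<le> K'" using RUU[of x] K' by linarith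
    show "\<bar>R x * (U x)\<^sup>2 + P x\<bar> \<le> K'" using RUU[of x] K(4)[of x] K' by linarith
    have "\<bar>real (n - 1) * P x\<bar> \<le> 2 * K"
      unfolding abs_mult using n_cases K(4)[of x] K0 by (intro mult_mono) auto
    then show "\<bar>real (n - 1) * P x\<bar> \<le> K'" using K' by linarith
    have "\<bar>(E x + P x) * U x\<bar> \<le> 2 * K * K" unfolding abs_mult using EP[of x] K(2)[of x] K0 by (intro mult_mono) auto
    then show "\<bar>(E x + P x) * U x\<bar> \<le> K'" using K' by linarith
    have "\<bar>R x * (x * U x)\<bar> \<le> K * K" unfolding abs_mult[of "R x"] using K[of x] K0 by (intro mult_mono) auto
    then show "\<bar>x * (R x * U x)\<bar> \<le> K'" using K' by (simp add: mult_ac)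
    have "\<bar>(E x + P x) * (x * U x)\<bar> \<le> 2 * K * K"
      unfolding abs_mult[of "E x + P x"] using EP[of x] K(3)[of x] K0 by (intro mult_mono) auto
    then show "\<bar>x * ((E x + P x) * U x)\<bar> \<le> K'" using K' by (simp add: mult_ac)
  qed
qed

section \<open>The similarity shock solution is a weak solution\<close>

text \<open>The last inequality makes the energy flux vanish at the centre. At \<open>\<theta> = 1\<close> its left-hand side is
\<open>n + 2 - 2 \<lambda>\<close>, which is positive by the upper bound for \<open>\<lambda>\<close>.\<close>

lemma decay_exponent:
  obtains \<theta> where "0 \<le> \<theta>" "\<theta> < 1" "real n + 2 - 3 * lam + lam * \<theta> > 0"
proof -
  have "3 - (real n + 2) / lam < 1" using lam_lt lam_gt_1 by (simp add: field_simps)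
  then obtain \<theta> where \<theta>: "max 0 (3 - (real n + 2) / lam) < \<theta>" "\<theta> < 1"
    using dense[of "max 0 (3 - (real n + 2) / lam)" 1] by auto
  then have "lam * (3 - (real n + 2) / lam) < lam * \<theta>"
    using lam_gt_1 by (intro mult_strict_left_mono) auto
  then have "real n + 2 - 3 * lam + lam * \<theta> > 0"
    using lam_gt_1 by (simp add: right_diff_distrib)
  with \<theta> show thesis by (intro that[of \<theta>]) auto
qed

lemma n_minus_1: "real (n - 1) = real n - 1"
  using n_cases by auto

text \<open>The velocity is at most of the order of \<open>1 / \<bar>x\<bar>\<close> at infinity, so the fluxes of mass and energy decay at
every rate \<open>\<theta> < 1\<close>. The momentum flux contains the pressure, for which only boundedness is known;
the test functions of that law vanish at the centre instead.\<close>

lemma balance_laws: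
  assumes \<theta>: "0 \<le> \<theta>" "\<theta> < 1"
  obtains K where
    "self_similar_balance_law R (\<lambda>x. R x * U x) (\<lambda>x. 0) {-1, B} (real (n - 1)) lam \<theta> K"
    "self_similar_balance_law (\<lambda>x. R x * U x) (\<lambda>x. R x * (U x)\<^sup>2 + P x) (\<lambda>x. real (n - 1) * P x)
      {-1, B} (real (n - 1) + 1 - lam) lam 0 K"
    "self_similar_balance_law E (\<lambda>x. (E x + P x) * U x) (\<lambda>x. 0) {-1, B} (real (n - 1) + 2 - 2 * lam) lam \<theta> K"
proof -
  obtain K where K: "\<And>x. \<bar>R x\<bar> \<le> K" "\<And>x. \<bar>R x * U x\<bar> \<le> K" "\<And>x. \<bar>R x * (U x)\<^sup>2 + P x\<bar> \<le> K"
    "\<And>x. \<bar>real (n - 1) * P x\<bar> \<le> K" "\<And>x. \<bar>E x\<bar> \<le> K" "\<And>x. \<bar>(E x + P x) * U x\<bar> \<le> K"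
    "\<And>x. \<bar>x * (R x * U x)\<bar> \<le> K" "\<And>x. \<bar>x * ((E x + P x) * U x)\<bar> \<le> K"
    by (rule flux_bounds) blast
  have K0: "0 \<le> K" using K(1)[of 0] by linarith
  have decay: "\<bar>f\<bar> \<le> K * \<bar>x\<bar> powr (-\<theta>)" if "\<bar>f\<bar> \<le> K" "\<bar>x * f\<bar> \<le> K" "x \<noteq> 0" for f x
    using that \<theta> by (intro bounded_decay_imp_powr_decay) auto
  have lam: "lam > 0" using lam_gt_1 by simp
  show thesis
  proof (rule that[of K])
    show "self_similar_balance_law R (\<lambda>x. R x * U x) (\<lambda>x. 0) {-1, B} (real (n - 1)) lam \<theta> K"
      using lam \<theta> K K0 decay[OF K(2) K(7)] jump_limits(1) profile_ODEs(1)
      by unfold_locales auto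
    show "self_similar_balance_law (\<lambda>x. R x * U x) (\<lambda>x. R x * (U x)\<^sup>2 + P x) (\<lambda>x. real (n - 1) * P x)
      {-1, B} (real (n - 1) + 1 - lam) lam 0 K"
      using lam K jump_limits(2) profile_ODEs(2) n_minus_1 n_cases lam_lt
      by unfold_locales auto
    show "self_similar_balance_law E (\<lambda>x. (E x + P x) * U x) (\<lambda>x. 0) {-1, B} (real (n - 1) + 2 - 2 * lam) lam \<theta> K"
      using lam \<theta> K K0 decay[OF K(6) K(8)] jump_limits(3) profile_ODEs(3) n_minus_1 n_cases lam_lt
      by unfold_locales auto
  qed
qed

text \<open>All densities and the momentum flux are of order \<open>r\<^bsup>2 - 2 \<lambda>\<^esup>\<close> at most near the centre, which is
integrable against \<open>r\<^sup>m\<close> because \<open>\<lambda> < 1 + n / 2\<close>. The three balance laws have exponents \<open>a = m\<close>,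
\<open>m + 1 - \<lambda>\<close> and \<open>m + 2 - 2 \<lambda>\<close>.\<close>

lemma weak_solution:
  fixes \<rho> u e :: "real \<times> real \<Rightarrow> real"
  assumes \<rho>: "\<And>t r. r > 0 \<Longrightarrow> \<rho> (t, r) = R (t / r powr lam)"
    and u: "\<And>t r. r > 0 \<Longrightarrow> u (t, r) = r powr (1 - lam) * U (t / r powr lam)"
    and e: "\<And>t r. r > 0 \<Longrightarrow> e (t, r) = energy_of_sound_speed \<gamma> (r powr (1 - lam) * A (t / r powr lam))"
  shows "radial_weak_solution (n - 1) (\<lambda>\<rho> e. (\<gamma> - 1) * \<rho> * e) \<rho> u e"
proof -
  define m where "m = n - 1"
  have m: "real m = real n - 1" unfolding m_def by (rule n_minus_1)
  have n: "real n = 2 \<or> real n = 3" using n_cases by auto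
  have lam0: "lam > 0" using lam_gt_1 by simp
  let ?p = "\<lambda>z. (\<gamma> - 1) * \<rho> z * e z"
  let ?E = "\<lambda>z. \<rho> z * (e z + (u z)\<^sup>2 / 2)"
  let ?M = "lebesgue_on half_plane"
  have hp: "half_plane \<in> sets borel" by (intro borel_open open_Times) auto
  have sq: "(y powr (1 - lam))\<^sup>2 = y powr (2 - 2 * lam)" for y
    by (simp add: power2_eq_square flip: powr_add)
  have e': "e (t, r) = r powr (2 - 2 * lam) * energy_of_sound_speed \<gamma> (A (t / r powr lam))" if "r > 0" for t r
    using e[OF that] by (simp add: energy_of_sound_speed_def power_mult_distrib sq)
  have p: "?p (t, r) = r powr (2 - 2 * lam) * P (t / r powr lam)" if "r > 0" for t r
    by (simp add: \<rho> e' that P_def ideal_pressure_def)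
  have E: "?E (t, r) = r powr (2 - 2 * lam) * E (t / r powr lam)" if "r > 0" for t r
    by (simp add: \<rho> e' u that E_def power_mult_distrib sq algebra_simps)
  have \<rho>u: "\<rho> (t, r) * u (t, r) = r powr (1 - lam) * (R (t / r powr lam) * U (t / r powr lam))" if "r > 0" for t r
    by (simp add: \<rho> u that)
  have \<rho>uu: "\<rho> (t, r) * (u (t, r))\<^sup>2 = r powr (2 - 2 * lam) * (R (t / r powr lam) * (U (t / r powr lam))\<^sup>2)"
    if "r > 0" for t r
    by (simp add: \<rho> u that power_mult_distrib sq)
  have Epu: "(?E (t, r) + ?p (t, r)) * u (t, r)
    = r powr (3 - 3 * lam) * ((E (t / r powr lam) + P (t / r powr lam)) * U (t / r powr lam))" if "r > 0" for t r
  proof -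
    have Ep: "?E (t, r) + ?p (t, r) = r powr (2 - 2 * lam) * (E (t / r powr lam) + P (t / r powr lam))"
      unfolding E[OF that] p[OF that] by (simp add: algebra_simps)
    have "r powr (3 - 3 * lam) = r powr (2 - 2 * lam) * r powr (1 - lam)"
      by (simp flip: powr_add)
    then show ?thesis
      by (subst Ep, subst u[OF that]) (simp add: mult_ac)
  qed
  have pw: "r ^ m = r powr m" if "r > 0" for r :: real using that by (simp add: powr_realpow)
  obtain \<theta> where \<theta>: "0 \<le> \<theta>" "\<theta> < 1" "real n + 2 - 3 * lam + lam * \<theta> > 0"
    by (rule decay_exponent)
  have "0 \<le> lam * \<theta>" using lam0 \<theta> by simp
  note beta_facts = this \<theta> n lam_lt m
  obtain K where laws:
    "self_similar_balance_law R (\<lambda>x. R x * U x) (\<lambda>x. 0) {-1, B} (real m) lam \<theta> K"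
    "self_similar_balance_law (\<lambda>x. R x * U x) (\<lambda>x. R x * (U x)\<^sup>2 + P x) (\<lambda>x. real m * P x)
      {-1, B} (real m + 1 - lam) lam 0 K"
    "self_similar_balance_law E (\<lambda>x. (E x + P x) * U x) (\<lambda>x. 0) {-1, B} (real m + 2 - 2 * lam) lam \<theta> K"
    unfolding m_def by (rule balance_laws[OF \<theta>(1,2)])
  obtain K' where K': "\<And>x. \<bar>R x\<bar> \<le> K'" "\<And>x. \<bar>R x * U x\<bar> \<le> K'" "\<And>x. \<bar>P x\<bar> \<le> K'" "\<And>x. \<bar>R x * (U x)\<^sup>2\<bar> \<le> K'"
    "\<And>x. \<bar>E x\<bar> \<le> K'"
    by (rule flux_bounds) blast
  have N: "finite {-1, B}" "0 \<notin> {-1, B}" using B_pos by auto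
  have measurable: "f \<in> borel_measurable ?M"
    if "\<And>t r. r > 0 \<Longrightarrow> f (t, r) = r powr \<alpha> * \<Phi> (t / r powr lam)" "\<Phi> \<in> borel_measurable borel" for f \<alpha> \<Phi>
  proof (subst measurable_cong)
    show "f z = (case z of (t, r) \<Rightarrow> r powr \<alpha> * \<Phi> (t / r powr lam))" if "z \<in> space ?M" for z
      using that \<open>\<And>t r. r > 0 \<Longrightarrow> f (t, r) = r powr \<alpha> * \<Phi> (t / r powr lam)\<close> by (cases z) auto
    show "(\<lambda>(t, r). r powr \<alpha> * \<Phi> (t / r powr lam)) \<in> borel_measurable ?M"
      using self_similar_measurable[OF that(2), of \<alpha> lam]
      by (intro measurable_restrict_space1 measurable_completion) simp
  qed
  have L1: "L1_loc_tr m f"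
    if f: "\<And>t r. r > 0 \<Longrightarrow> f (t, r) = r powr \<alpha> * \<Phi> (t / r powr lam)" and [measurable]: "\<Phi> \<in> borel_measurable borel"
      and \<Phi>: "\<And>x. \<bar>\<Phi> x\<bar> \<le> K'" and \<alpha>: "\<alpha> + m > -1" for f \<alpha> \<Phi>
  proof (rule L1_loc_tr_powr_bound)
    show "f (t, r) * r ^ m = (\<lambda>(t, r). r powr (\<alpha> + m) * \<Phi> (t / r powr lam)) (t, r)" if "r > 0" for t r
      using that by (simp add: f pw powr_add)
    show "(\<lambda>(t, r). r powr (\<alpha> + m) * \<Phi> (t / r powr lam)) \<in> borel_measurable borel" by measurable
    show "\<bar>(\<lambda>(t, r). r powr (\<alpha> + m) * \<Phi> (t / r powr lam)) (t, r)\<bar> \<le> K' * (\<bar>t\<bar> powr (-0) * r powr (\<alpha> + m))"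
      if "r > 0" "t \<noteq> 0" for t r
      using that \<Phi>[of "t / r powr lam"] by (simp add: abs_mult mult.commute mult_left_mono)
  qed (use \<alpha> in auto)
  have cong: "has_bochner_integral ?M g 0 \<Longrightarrow> (\<And>t r. r > 0 \<Longrightarrow> f (t, r) = g (t, r)) \<Longrightarrow> has_bochner_integral ?M f 0" for f g :: "real \<times> real \<Rightarrow> real"
    by (erule has_bochner_integral_cong[THEN iffD1, rotated -1]) auto
  have "L1_loc_tr m (\<lambda>z. (?E z + ?p z) * u z)"
  proof (rule L1_loc_tr_powr_bound)
    interpret self_similar_balance_law E "\<lambda>x. (E x + P x) * U x" "\<lambda>x. 0" "{-1, B}" "real m + 2 - 2 * lam" lam \<theta> K
      by (rule laws(3))
    let ?g = "\<lambda>(t, r). r powr (3 - 3 * lam + m) * ((E (t / r powr lam) + P (t / r powr lam)) * U (t / r powr lam))"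
    show "(?E (t, r) + ?p (t, r)) * u (t, r) * r ^ m = ?g (t, r)" if "r > 0" for t r
      using that by (simp only: Epu pw powr_add) simp
    show "?g \<in> borel_measurable borel"
      using self_similar_measurable[OF profile_measurable(2)] .
    show "\<bar>?g (t, r)\<bar> \<le> K * (\<bar>t\<bar> powr (-\<theta>) * r powr (3 - 3 * lam + m + lam * \<theta>))" if "r > 0" "t \<noteq> 0" for t r
      using decay_powr[OF that profile_decay(1)] that by (simp add: abs_mult)
  qed (use \<theta> m in auto)
  moreover have "has_bochner_integral ?M
      (\<lambda>(t, r). (\<rho> (t, r) * \<psi>t (t, r) + \<rho> (t, r) * u (t, r) * \<psi>r (t, r)) * r ^ m) 0"
    if test: "test_C1c \<psi> \<psi>t \<psi>r" for \<psi> \<psi>t \<psi>r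
  proof -
    obtain T b M where "radial_test_function \<psi> \<psi>t \<psi>r T b M 0"
      by (rule radial_test_function_C1c[OF test])
    with laws(1) interpret tested_self_similar_balance_law R "\<lambda>x. R x * U x" "\<lambda>x. 0" "{-1, B}" m lam \<theta> K \<psi> \<psi>t \<psi>r T b M 0
      unfolding tested_self_similar_balance_law_def tested_self_similar_balance_law_axioms_def
      using beta_facts by (auto simp: self_similar_balance_law.\<beta>_def)
    show ?thesis
    proof (rule cong[OF weak_balance_law])
      fix t r :: real assume r: "r > 0"
      have "r powr (m + 1 - lam) = r powr m * r powr (1 - lam)" by (simp add: algebra_simps flip: powr_add)
      then show "(\<lambda>(t, r). (\<rho> (t, r) * \<psi>t (t, r) + \<rho> (t, r) * u (t, r) * \<psi>r (t, r)) * r ^ m) (t, r) = weak_integrand (t, r)"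
        by (simp add: weak_integrand_def u[OF r] pw[OF r] \<rho>[OF r] algebra_simps)
    qed
  qed
  moreover have "has_bochner_integral ?M
      (\<lambda>(t, r). (\<rho> (t, r) * u (t, r) * \<psi>t (t, r) + \<rho> (t, r) * (u (t, r))\<^sup>2 * \<psi>r (t, r)
        + ?p (t, r) * (\<psi>r (t, r) + real m * \<psi> (t, r) / r)) * r ^ m) 0"
    if test: "test_C10 \<psi> \<psi>t \<psi>r" for \<psi> \<psi>t \<psi>r
  proof -
    obtain T b M where "radial_test_function \<psi> \<psi>t \<psi>r T b M 1"
      by (rule radial_test_function_C10[OF test])
    with laws(2) interpret tested_self_similar_balance_law "\<lambda>x. R x * U x" "\<lambda>x. R x * (U x)\<^sup>2 + P x" "\<lambda>x. real m * P x"
        "{-1, B}" "m + 1 - lam" lam 0 K \<psi> \<psi>t \<psi>r T b M 1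
      unfolding tested_self_similar_balance_law_def tested_self_similar_balance_law_axioms_def
      using beta_facts by (auto simp: self_similar_balance_law.\<beta>_def)
    show ?thesis
    proof (rule cong[OF weak_balance_law])
      fix t r :: real assume r: "r > 0"
      have "r powr (m + 1 - lam) = r powr m * r powr (1 - lam)"
        "r powr (m + 1 - lam + 1 - lam) = r powr m * r powr (2 - 2 * lam)"
        "r powr (m + 1 - lam - lam) = r powr m * r powr (2 - 2 * lam) / r"
        using r by (simp_all add: algebra_simps powr_diff powr_add power2_eq_square)
      then show "(\<lambda>(t, r). (\<rho> (t, r) * u (t, r) * \<psi>t (t, r) + \<rho> (t, r) * (u (t, r))\<^sup>2 * \<psi>r (t, r)
        + ?p (t, r) * (\<psi>r (t, r) + real m * \<psi> (t, r) / r)) * r ^ m) (t, r) = weak_integrand (t, r)"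
        unfolding weak_integrand_def prod.case \<rho>u[OF r] \<rho>uu[OF r] p[OF r] pw[OF r] by (simp add: algebra_simps)
    qed
  qed
  moreover have "has_bochner_integral ?M
      (\<lambda>(t, r). (?E (t, r) * \<psi>t (t, r) + (?E (t, r) + ?p (t, r)) * u (t, r) * \<psi>r (t, r)) * r ^ m) 0"
    if test: "test_C1c \<psi> \<psi>t \<psi>r" for \<psi> \<psi>t \<psi>r
  proof -
    obtain T b M where "radial_test_function \<psi> \<psi>t \<psi>r T b M 0"
      by (rule radial_test_function_C1c[OF test])
    with laws(3) interpret tested_self_similar_balance_law E "\<lambda>x. (E x + P x) * U x" "\<lambda>x. 0" "{-1, B}" "m + 2 - 2 * lam" lam \<theta> K
        \<psi> \<psi>t \<psi>r T b M 0
      unfolding tested_self_similar_balance_law_def tested_self_similar_balance_law_axioms_def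
      using beta_facts by (auto simp: self_similar_balance_law.\<beta>_def)
    show ?thesis
    proof (rule cong[OF weak_balance_law])
      fix t r :: real assume r: "r > 0"
      have "r powr (m + 2 - 2 * lam) = r powr m * r powr (2 - 2 * lam)"
        "r powr (m + 2 - 2 * lam + 1 - lam) = r powr m * r powr (3 - 3 * lam)"
        by (simp_all add: algebra_simps flip: powr_add)
      then show "(\<lambda>(t, r). (?E (t, r) * \<psi>t (t, r) + (?E (t, r) + ?p (t, r)) * u (t, r) * \<psi>r (t, r)) * r ^ m) (t, r) = weak_integrand (t, r)"
        unfolding weak_integrand_def prod.case pw[OF r]
        by (subst Epu[OF r], subst E[OF r]) (simp add: algebra_simps)
    qed
  qed
  moreover have "continuous_L1_loc m \<rho>"
    using continuous_L1_loc_self_similar[of \<rho> 0 R lam K' "{-1, B}" m] \<rho> K' N profiles_isCont lam0 by auto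
  moreover have "continuous_L1_loc m (\<lambda>z. \<rho> z * u z)"
    by (rule continuous_L1_loc_self_similar[OF \<rho>u _ K'(2) N])
      (use profiles_isCont lam0 m n lam_lt in auto)
  moreover have "continuous_L1_loc m ?E"
    by (rule continuous_L1_loc_self_similar[OF E _ K'(5) N])
      (use P_E_isCont lam0 m n lam_lt in auto)
  moreover have "L1_loc_tr m (\<lambda>z. \<rho> z * (u z)\<^sup>2)"
    by (rule L1[OF \<rho>uu _ K'(4)]) (use m n lam_lt in auto)
  moreover have "L1_loc_tr m ?p"
    by (rule L1[OF p _ K'(3)]) (use m n lam_lt in auto)
  moreover have "\<rho> \<in> borel_measurable ?M" "u \<in> borel_measurable ?M" "e \<in> borel_measurable ?M"
    using measurable[of \<rho> 0 R] measurable[OF u] measurable[OF e'] \<rho>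
    by (auto simp: energy_of_sound_speed_def[abs_def])
  moreover have "AE z in ?M. \<rho> z > 0 \<and> e z \<ge> 0"
  proof (rule AE_I2)
    fix z assume "z \<in> space ?M"
    then show "\<rho> z > 0 \<and> e z \<ge> 0"
      using R_pos gamma_gt_1 by (cases z) (auto simp: \<rho> e energy_of_sound_speed_def)
  qed
  moreover have "\<forall>a>0. \<forall>b\<ge>0. (\<gamma> - 1) * a * b \<ge> 0" using gamma_gt_1 by simp
  ultimately show ?thesis
    unfolding radial_weak_solution_def Let_def m_def by blast
qed

end

theorem theorem6p2:
  fixes n m :: nat and \<gamma> lam B l L :: real
    and R V C :: "real \<Rightarrow> real"
    and \<rho> u c e :: "real \<times> real \<Rightarrow> real"
  assumes "n = 2 \<or> n = 3" and "m = n - 1" and "\<gamma> > 1"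
    and "similarity_shock_solution n \<gamma> lam B R V C l L"
    and P1: "\<exists>a b. 0 < a \<and> (\<forall>x. a \<le> 1 + V x \<and> 1 + V x \<le> b)"
    and P2: "((\<lambda>x. V x / x) \<longlongrightarrow> l) (at 0)" "((\<lambda>x. C x / x) \<longlongrightarrow> L) (at 0)" "L < 0" "0 < l"
    and P3: "(V \<longlongrightarrow> - 2 * (lam - 1) / (real n * \<gamma>)) at_top" "filterlim C at_bot at_top"
    and rho: "\<And>t r. r > 0 \<Longrightarrow> \<rho> (t, r) = R (t / r powr lam)"
    and u: "\<And>t r. r > 0 \<Longrightarrow>
          u (t, r) = - (r powr (1 - lam) / lam) * quot_at0 V l (t / r powr lam)"
    and c: "\<And>t r. r > 0 \<Longrightarrow>
          c (t, r) = - (r powr (1 - lam) / lam) * quot_at0 C L (t / r powr lam)"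
    and e: "\<And>t r. r > 0 \<Longrightarrow> e (t, r) = (c (t, r))\<^sup>2 / (\<gamma> * (\<gamma> - 1))"
    and "1 < lam" and "lam < 1 + real n / 2"
  shows "radial_weak_solution m (\<lambda>\<rho> e. (\<gamma> - 1) * \<rho> * e) \<rho> u e"
proof -
  have "bounded_shock_solution n \<gamma> lam B R V C l L"
    using assms(4) P1 P3(1) \<open>lam < 1 + real n / 2\<close>
    unfolding bounded_shock_solution_def bounded_shock_solution_axioms_def by blast
  then interpret bounded_shock_solution n \<gamma> lam B R V C l L .
  show ?thesis
    unfolding \<open>m = n - 1\<close>
  proof (rule weak_solution)
    show "\<rho> (t, r) = R (t / r powr lam)" if "r > 0" for t r using rho[OF that] .
    show "u (t, r) = r powr (1 - lam) * speed_profile lam V l (t / r powr lam)" if "r > 0" for t r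
      using u[OF that] by (simp add: speed_profile_def)
    show "e (t, r) = energy_of_sound_speed \<gamma> (r powr (1 - lam) * speed_profile lam C L (t / r powr lam))"
      if "r > 0" for t r
      using e[OF that] c[OF that] by (simp add: speed_profile_def energy_of_sound_speed_def)
  qed
qed

end
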